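(* (Generic local Torelli theorem) For a general lattice $\Lambda\subset\mathbb{E}^n$ we have $\det\mathrm{D}\Theta_\Lambda\neq0$. This means that the $\Theta$-map is generically locally injective.
   Context: $\mathbb{E}^n$ is Euclidean $n$-space. $\mathrm{Quad}_n^+$ is the open cone of positive definite real symmetric $n\times n$ matrices in the space of all real symmetric $n\times n$ matrices. The theta map $\Theta$ assigns to $A\in\mathrm{Quad}_n^+$ the holomorphic function $\Theta_A(z)=\sum_{\lambda\in\mathbb{Z}^n}\exp(2\pi i({}^t\lambda A\lambda)z)$ on the upper half plane. The lattice $\Lambda\subset\mathbb{E}^n$ associated to $A$ is generated by the columns of a real matrix $Q$ with $A={}^tQQ$; it is unique up to $\mathrm{O}(n)$, and every (rank $n$) lattice in $\mathbb{E}^n$ arises in this way. Let $m=\frac{n^2+n-2}{2}$, the dimension of the space of real homogeneous harmonic polynomials of degree two on $\mathbb{E}^n$ (quadratic forms with symmetric matrix of trace $0$), with scalar product $\langle h,h'\rangle=2\,\mathrm{tr}(hh')$ on symmetric matrices. For harmonic $h$ put $\Theta_{h;\Lambda}(z)=\sum_{\lambda\in\Lambda}h(\lambda)\exp(2\pi i\|\lambda\|^2z)$. For an orthonormal basis $h_1,\dots,h_m$ of the harmonic quadratic forms, $$\det\mathrm{D}\Theta_\Lambda(z)=\det\left(\Bigl(\tfrac{1}{2\pi i}\tfrac{\partial}{\partial z}\Bigr)^{k}\Theta_{h_j;\Lambda}(z)\right)_{0\le k\le m-1,\ 1\le j\le m},$$ a function of $z$ which is independent of the orthonormal basis up to sign;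 $\det\mathrm{D}\Theta_\Lambda\neq0$ means that it is not the zero function. *)

theory Defs
  imports "Jordan_Normal_Form.Determinant" "HOL-Analysis.Analysis"
begin

(* Two matrix libraries are in play: real^'n^'n for objects on Euclidean n-space, n = CARD('n), and
   'a mat for the determinant whose size m is a function of n. The clashing infixes are given
   to the former; Matrix.mat and Determinant.det are always written qualified. *)
no_notation vec_index (infixl \<open>$\<close> 100)
no_notation scalar_prod (infix \<open>\<bullet>\<close> 70)

definition upper_half_plane :: "complex set" where
  "upper_half_plane = {z. 0 < Im z}"

definition quad_form :: "real^'n^'n \<Rightarrow> real^'n \<Rightarrow> real" where
  "quad_form A x = x \<bullet> (A *v x)"

definition Quad_pos :: "(real^'n^'n) set" where
  "Quad_pos = {A. transpose A = A \<and> (\<forall>x. x \<noteq> 0 \<longrightarrow> 0 < quad_form A x)}"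

definition int_vectors :: "(real^'n) set" where
  "int_vectors = {x. \<forall>i. x $ i \<in> \<int>}"

(* Restricting to the upper half plane makes equality of values of Theta
   the equality of holomorphic functions on the upper half plane. *)
definition Theta :: "real^'n^'n \<Rightarrow> complex \<Rightarrow> complex" where
  "Theta A = restrict
     (\<lambda>z. \<Sum>\<^sub>\<infinity>l\<in>int_vectors. exp (2 * of_real pi * \<i> * of_real (quad_form A l) * z))
     upper_half_plane"

definition column_lattice :: "real^'n^'n \<Rightarrow> (real^'n) set" where
  "column_lattice Q = (\<lambda>x. Q *v x) ` int_vectors"

(* For a positive definite A the matrix Q, hence the lattice, is unique up to O(n) only. *)
definition is_lattice_of :: "real^'n^'n \<Rightarrow> (real^'n) set \<Rightarrow> bool" where
  "is_lattice_of A L \<longleftrightarrow> (\<exists>Q. A = transpose Q ** Q \<and> L = column_lattice Q)"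

(* A quadratic form is represented by its symmetric matrix; it is harmonic iff the trace is 0. *)
definition harmonic_forms :: "(real^'n^'n) set" where
  "harmonic_forms = {H. transpose H = H \<and> trace H = 0}"

(* The dimension of harmonic_forms. As n >= 1, the subtraction does not truncate. *)
definition harmonic_dim :: "'n::finite itself \<Rightarrow> nat" where
  "harmonic_dim _ = (CARD('n)^2 + CARD('n) - 2) div 2"

definition form_inner :: "real^'n^'n \<Rightarrow> real^'n^'n \<Rightarrow> real" where
  "form_inner H H' = 2 * trace (H ** H')"

(* The basis is h 0, ..., h (m-1); other values of h are irrelevant. *)
definition orthonormal_harmonic_basis :: "(nat \<Rightarrow> real^'n^'n) \<Rightarrow> bool" where
  "orthonormal_harmonic_basis h \<longleftrightarrow>
     (\<forall>i<harmonic_dim TYPE('n). \<forall>j<harmonic_dim TYPE('n).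
        form_inner (h i) (h j) = (if i = j then 1 else 0)) \<and>
     span (h ` {..<harmonic_dim TYPE('n)}) = harmonic_forms"

definition Theta_harmonic :: "real^'n^'n \<Rightarrow> (real^'n) set \<Rightarrow> complex \<Rightarrow> complex" where
  "Theta_harmonic H L z =
     (\<Sum>\<^sub>\<infinity>l\<in>L. of_real (quad_form H l) * exp (2 * of_real pi * \<i> * of_real ((norm l)^2) * z))"

definition ddz :: "(complex \<Rightarrow> complex) \<Rightarrow> complex \<Rightarrow> complex" where
  "ddz f z = 1 / (2 * of_real pi * \<i>) * deriv f z"

definition det_DTheta :: "(nat \<Rightarrow> real^'n^'n) \<Rightarrow> (real^'n) set \<Rightarrow> complex \<Rightarrow> complex" where
  "det_DTheta h L z = Determinant.det
     (Matrix.mat (harmonic_dim TYPE('n)) (harmonic_dim TYPE('n))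
        (\<lambda>(k, j). (ddz ^^ k) (Theta_harmonic (h j) L) z))"

(* "For general x in S": on an open dense subset of S. *)
definition generically :: "'a::topological_space set \<Rightarrow> ('a \<Rightarrow> bool) \<Rightarrow> bool" where
  "generically S P \<longleftrightarrow>
     (\<exists>G. openin (top_of_set S) G \<and> S \<subseteq> closure G \<and> (\<forall>x\<in>G. P x))"

definition locally_injective_at :: "'a::topological_space set \<Rightarrow> ('a \<Rightarrow> 'b) \<Rightarrow> 'a \<Rightarrow> bool" where
  "locally_injective_at S f x \<longleftrightarrow> (\<exists>V. openin (top_of_set S) V \<and> x \<in> V \<and> inj_on f V)"

end

theory Submission
  imports Defs "HOL-Complex_Analysis.Cauchy_Integral_Formula"
begin

text \<open>
  On the imaginary axis every theta series becomes an exponential sum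
  \<open>\<Sum> w\<^sub>i exp (- y q\<^sub>i)\<close> with real weights and exponents. Only finitely many
  exponents lie below any given bound, so the behaviour for \<open>y \<rightarrow> \<infinity>\<close> isolates the lowest exponent of nonzero total
  weight. Both assertions are consequences of this one observation
  (\<open>leading_term_tendsto\<close>), applied to forms of the following kind.

  Call a positive definite \<open>A\<close> generic if the value of \<open>A\<close> at each vector \<open>e\<^sub>i + e\<^sub>j\<close> is taken on
  the integer vectors only at \<open>e\<^sub>i + e\<^sub>j\<close> and its negative. These finitely many vectors suffice to
  determine a symmetric matrix. Generic forms are open, because near a given form only
  finitely many integer vectors have values below a given bound, so that the finitely many
  inequalities involved hold with a uniform gap (\<open>generic_forms_isolated\<close>). They are dense, because
  a coincidence \<open>A(m) = A(l)\<close> with \<open>m \<noteq> \<plusminus>l\<close> excludes a hyperplane, and a line \<open>A + t v v\<^sup>T\<close> with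
  \<open>v\<close> not orthogonal to any nonzero integer vector meets each of these countably many
  hyperplanes at most once (\<open>generic_forms_dense\<close>).

  Local injectivity: equal theta functions have equal sets of exponents. If \<open>B\<close> and \<open>C\<close> are close to a
  generic \<open>A\<close> and have the same theta function, then \<open>B(e\<^sub>i + e\<^sub>j) = C(m)\<close> for some integer vector
  \<open>m\<close>; the gap forces \<open>m = \<plusminus>(e\<^sub>i + e\<^sub>j)\<close>, so \<open>B\<close> and \<open>C\<close> agree on all these vectors and are equal.

  The determinant: it is a Wronskian for the operator \<open>D = (1 / 2 \<pi> i) d/dz\<close>, which multiplies
  \<open>exp (2 \<pi> i q z)\<close> by \<open>q\<close>. For generic \<open>A\<close> the exponent \<open>A(e\<^sub>i + e\<^sub>j)\<close> occurs in the theta series of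
  \<open>h\<close> with coefficient \<open>2 h(Q (e\<^sub>i + e\<^sub>j))\<close>, and thus the theta series of a basis of forms are linearly
  independent. A space of dimension \<open>m\<close> of exponential sums realises at least \<open>m\<close> different lowest
  exponents \<open>a\<^sub>i\<close>, since avoiding fewer than \<open>m\<close> exponents is a system of fewer than \<open>m\<close> linear
  conditions. Choosing combinations with \<open>m\<close> distinct lowest exponents multiplies the Wronskian by
  a constant, and after rescaling by \<open>exp (y a\<^sub>i)\<close> the result tends to a nonzero multiple of the
  Vandermonde determinant of the \<open>a\<^sub>i\<close>
  (\<open>exponential_wronskian_nonzero\<close>).
\<close>

section \<open>Exponential sums with real exponents\<close>

text \<open>
  Requiring convergence for every \<open>y > 0\<close>, with nothing about the size of the weights, makes the
  class closed under multiplication of the weights by nonnegative exponents, that is, under termwise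
  differentiation.
\<close>

definition heat_summable :: "'i set \<Rightarrow> ('i \<Rightarrow> real) \<Rightarrow> ('i \<Rightarrow> real) \<Rightarrow> bool" where
  "heat_summable I q w \<longleftrightarrow> (\<forall>y>0. (\<lambda>i. \<bar>w i\<bar> * exp (- (y * q i))) summable_on I)"

lemma heat_summable_abs:
  assumes "heat_summable I q w" "0 < y"
  shows "(\<lambda>i. \<bar>w i\<bar> * exp (- (y * q i))) summable_on I"
  using assms by (simp add: heat_summable_def)

lemma heat_summable_sum:
  assumes "heat_summable I q w" "0 < y"
  shows "(\<lambda>i. w i * exp (- (y * q i))) summable_on I"
  by (rule abs_summable_summable) (use heat_summable_abs[OF assms] in \<open>simp add: abs_mult\<close>)

lemma heat_summable_subset:
  assumes "heat_summable I q w" "J \<subseteq> I"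
  shows "heat_summable J q w"
  using assms summable_on_subset_banach unfolding heat_summable_def by blast

lemma heat_summable_comparison:
  assumes "heat_summable I q w" "\<And>i. i \<in> I \<Longrightarrow> \<bar>u i\<bar> \<le> K * \<bar>w i\<bar>"
  shows "heat_summable I q u"
  unfolding heat_summable_def
proof (intro allI impI)
  fix y :: real assume y: "0 < y"
  have "(\<lambda>i. K * (\<bar>w i\<bar> * exp (- (y * q i)))) summable_on I"
    by (intro summable_on_cmult_right heat_summable_abs[OF assms(1) y])
  then show "(\<lambda>i. \<bar>u i\<bar> * exp (- (y * q i))) summable_on I"
    by (rule summable_on_comparison_test)
       (use assms(2) in \<open>auto simp flip: mult.assoc intro!: mult_right_mono\<close>)
qed

text \<open>
  Half of the decay pays for the extra factor: \<open>t exp (- y t)\<close> is at most a constant times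
  \<open>exp (- y t / 2)\<close>.
\<close>

lemma heat_summable_times_exponent:
  assumes w: "heat_summable I q w" and q: "\<And>i. i \<in> I \<Longrightarrow> 0 \<le> q i"
  shows "heat_summable I q (\<lambda>i. w i * q i)"
  unfolding heat_summable_def
proof (intro allI impI)
  fix y :: real assume y: "0 < y"
  have le: "t * exp (- (y * t)) \<le> 2 / y * exp (- (y / 2 * t))" if "0 \<le> t" for t
  proof -
    have "y / 2 * t \<le> exp (y / 2 * t)"
      using exp_ge_add_one_self[of "y / 2 * t"] by linarith
    then have "t \<le> 2 / y * exp (y / 2 * t)"
      using y by (simp add: field_simps)
    then have "t * exp (- (y * t)) \<le> 2 / y * exp (y / 2 * t) * exp (- (y * t))"
      by (rule mult_right_mono) simp
    also have "\<dots> = 2 / y * exp (- (y / 2 * t))"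
      by (simp add: field_simps flip: exp_add)
    finally show ?thesis .
  qed
  have "(\<lambda>i. 2 / y * (\<bar>w i\<bar> * exp (- (y / 2 * q i)))) summable_on I"
    by (intro summable_on_cmult_right heat_summable_abs[OF w]) (use y in simp)
  then show "(\<lambda>i. \<bar>w i * q i\<bar> * exp (- (y * q i))) summable_on I"
  proof (rule summable_on_comparison_test)
    fix i assume i: "i \<in> I"
    have "\<bar>w i * q i\<bar> * exp (- (y * q i)) = \<bar>w i\<bar> * (q i * exp (- (y * q i)))"
      using q[OF i] by (simp add: abs_mult)
    also have "\<dots> \<le> \<bar>w i\<bar> * (2 / y * exp (- (y / 2 * q i)))"
      by (intro mult_left_mono le q i) simp
    finally show "\<bar>w i * q i\<bar> * exp (- (y * q i)) \<le> 2 / y * (\<bar>w i\<bar> * exp (- (y / 2 * q i)))"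
      by (simp add: mult_ac)
  qed auto
qed

lemma heat_summable_times_exponent_power:
  assumes w: "heat_summable I q w" and q: "\<And>i. i \<in> I \<Longrightarrow> 0 \<le> q i"
  shows "heat_summable I q (\<lambda>i. w i * q i ^ k)"
proof (induction k)
  case (Suc k)
  show ?case
    using heat_summable_times_exponent[OF Suc q] by (simp add: mult_ac)
qed (use w in simp)

text \<open>
  With weights \<open>1\<close>, each index with exponent at most \<open>C\<close> contributes at least
  \<open>exp (- C)\<close> to a convergent sum.
\<close>

lemma finite_exponents_below:
  assumes "heat_summable I q (\<lambda>_. 1)"
  shows "finite {i \<in> I. q i \<le> C}"
proof (rule ccontr)
  assume inf: "infinite {i \<in> I. q i \<le> C}"
  have "(\<lambda>i. exp (- q i)) summable_on {i \<in> I. q i \<le> C}"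
    using heat_summable_abs[OF heat_summable_subset[OF assms], of "{i \<in> I. q i \<le> C}" 1] by simp
  then have "(\<lambda>i. exp (- C)) summable_on {i \<in> I. q i \<le> C}"
    by (rule summable_on_comparison_test) auto
  then have "exp (- C) = 0"
    using inf infsum_diverge_constant[of "{i \<in> I. q i \<le> C}" "exp (- C)"] by auto
  then show False by simp
qed

text \<open>
  The coefficient of \<open>exp (- y a)\<close> after collecting equal exponents. The sum is over a finite set
  wherever exponents are finite below every bound.
\<close>

definition level_weight :: "'i set \<Rightarrow> ('i \<Rightarrow> real) \<Rightarrow> ('i \<Rightarrow> real) \<Rightarrow> real \<Rightarrow> real" where
  "level_weight I q w a = (\<Sum>i | i \<in> I \<and> q i = a. w i)"

text \<open>
  For \<open>y \<ge> 1\<close> the sum at \<open>y\<close> is at most \<open>exp (- (y - 1) b)\<close> times the absolute sum at \<open>1\<close>, so it decays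
  faster than \<open>exp (- y a)\<close>.
\<close>

lemma tail_tendsto_0:
  assumes w: "heat_summable I q w" and gap: "\<And>i. i \<in> I \<Longrightarrow> b \<le> q i" and ab: "a < b"
  shows "((\<lambda>y. exp (y * a) * (\<Sum>\<^sub>\<infinity>i\<in>I. w i * exp (- (y * q i)))) \<longlongrightarrow> 0) at_top"
proof -
  define M where "M = (\<Sum>\<^sub>\<infinity>i\<in>I. \<bar>w i\<bar> * exp (- (1 * q i)))"
  have le: "norm (exp (y * a) * (\<Sum>\<^sub>\<infinity>i\<in>I. w i * exp (- (y * q i))))
      \<le> M * exp b * exp (- (y * (b - a)))" if y: "1 \<le> y" for y
  proof -
    have s: "(\<lambda>i. \<bar>w i\<bar> * exp (- (y * q i))) summable_on I"
      using y by (intro heat_summable_abs[OF w]) auto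
    have "norm (\<Sum>\<^sub>\<infinity>i\<in>I. w i * exp (- (y * q i))) \<le> (\<Sum>\<^sub>\<infinity>i\<in>I. norm (w i * exp (- (y * q i))))"
      using s by (intro norm_infsum_bound) (simp add: abs_mult)
    also have "\<dots> = (\<Sum>\<^sub>\<infinity>i\<in>I. \<bar>w i\<bar> * exp (- (y * q i)))"
      by (simp add: abs_mult)
    also have "\<dots> \<le> (\<Sum>\<^sub>\<infinity>i\<in>I. (\<bar>w i\<bar> * exp (- (1 * q i))) * exp (- ((y - 1) * b)))"
    proof (rule infsum_mono[OF s])
      show "(\<lambda>i. (\<bar>w i\<bar> * exp (- (1 * q i))) * exp (- ((y - 1) * b))) summable_on I"
        by (intro summable_on_cmult_left heat_summable_abs[OF w]) simp
      fix i assume i: "i \<in> I"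
      have "(y - 1) * b \<le> (y - 1) * q i"
        using y gap[OF i] by (intro mult_left_mono) auto
      then have "exp (- (y * q i)) \<le> exp (- (1 * q i)) * exp (- ((y - 1) * b))"
        by (simp add: algebra_simps flip: exp_add)
      then show "\<bar>w i\<bar> * exp (- (y * q i)) \<le> (\<bar>w i\<bar> * exp (- (1 * q i))) * exp (- ((y - 1) * b))"
        by (simp only: mult.assoc) (intro mult_left_mono, auto)
    qed
    also have "\<dots> = M * exp (- ((y - 1) * b))"
      unfolding M_def by (rule infsum_cmult_left')
    finally have "exp (y * a) * norm (\<Sum>\<^sub>\<infinity>i\<in>I. w i * exp (- (y * q i)))
        \<le> exp (y * a) * (M * exp (- ((y - 1) * b)))"
      by (rule mult_left_mono) simp
    also have "\<dots> = M * exp b * exp (- (y * (b - a)))"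
      by (simp add: algebra_simps flip: exp_add)
    finally show ?thesis by (simp add: abs_mult)
  qed
  have "filterlim (\<lambda>y. - (y * (b - a))) at_bot at_top"
    unfolding filterlim_uminus_at_bot mult.commute[of _ "b - a"] minus_minus
    by (rule filterlim_tendsto_pos_mult_at_top[OF tendsto_const _ filterlim_ident]) (use ab in simp)
  then have "((\<lambda>y. exp (- (y * (b - a)))) \<longlongrightarrow> 0) at_top"
    by (rule filterlim_compose[OF exp_at_bot])
  then have "((\<lambda>y. M * exp b * exp (- (y * (b - a)))) \<longlongrightarrow> 0) at_top"
    by (rule tendsto_mult_right_zero)
  then show ?thesis
    by (rule Lim_null_comparison[rotated]) (rule eventually_mono[OF eventually_ge_at_top[of 1]], rule le)
qed

text \<open>
  The finitely many terms with exponent at most \<open>a\<close> collect to the single level \<open>a\<close>; the remaining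
  exponents stay a positive distance above \<open>a\<close>, again by finiteness.
\<close>

lemma leading_term_tendsto:
  assumes w: "heat_summable I q w" and fin: "\<And>C. finite {i \<in> I. q i \<le> C}"
    and lower: "\<And>a'. a' < a \<Longrightarrow> level_weight I q w a' = 0"
  shows "((\<lambda>y. exp (y * a) * (\<Sum>\<^sub>\<infinity>i\<in>I. w i * exp (- (y * q i))))
           \<longlongrightarrow> level_weight I q w a) at_top"
proof -
  define J where "J = {i \<in> I. q i \<le> a}"
  define K where "K = {i \<in> I. a < q i}"
  have finJ: "finite J" unfolding J_def by (rule fin)
  \<comment> \<open>The exponents above \<open>a\<close> have a least element if any of them is at most \<open>a + 1\<close>.\<close>
  obtain b where b: "a < b" "\<And>i. i \<in> K \<Longrightarrow> b \<le> q i"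
  proof (cases "{i \<in> K. q i \<le> a + 1} = {}")
    case True
    then show ?thesis by (intro that[of "a + 1"]) auto
  next
    case False
    have f: "finite {i \<in> K. q i \<le> a + 1}"
      using fin[of "a + 1"] by (rule finite_subset[rotated]) (auto simp: K_def)
    let ?b = "Min (q ` {i \<in> K. q i \<le> a + 1})"
    have "a < ?b" using f False by (subst Min_gr_iff) (auto simp: K_def)
    moreover have "?b \<le> q i" if "i \<in> K" for i
    proof (cases "q i \<le> a + 1")
      case True then show ?thesis using f that by (intro Min_le) auto
    next
      case i: False
      obtain j where "j \<in> {i \<in> K. q i \<le> a + 1}" using False by blast
      then have "?b \<le> q j" "q j \<le> a + 1" using f by (auto intro!: Min_le)
      then show ?thesis using i by linarith
    qed
    ultimately show ?thesis by (rule that)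
  qed
  have wK: "heat_summable K q w" using w by (rule heat_summable_subset) (auto simp: K_def)
  have split: "exp (y * a) * (\<Sum>\<^sub>\<infinity>i\<in>I. w i * exp (- (y * q i)))
      = level_weight I q w a + exp (y * a) * (\<Sum>\<^sub>\<infinity>i\<in>K. w i * exp (- (y * q i)))" if y: "0 < y" for y
  proof -
    have "(\<Sum>\<^sub>\<infinity>i\<in>I. w i * exp (- (y * q i))) = (\<Sum>\<^sub>\<infinity>i\<in>J \<union> K. w i * exp (- (y * q i)))"
      by (rule arg_cong[where f = "infsum _"]) (auto simp: J_def K_def)
    also have "\<dots> = (\<Sum>\<^sub>\<infinity>i\<in>J. w i * exp (- (y * q i))) + (\<Sum>\<^sub>\<infinity>i\<in>K. w i * exp (- (y * q i)))"
      using finJ y by (intro infsum_Un_disjoint summable_on_finite heat_summable_sum[OF wK])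
        (auto simp: J_def K_def)
    also have "(\<Sum>\<^sub>\<infinity>i\<in>J. w i * exp (- (y * q i))) = (\<Sum>i\<in>J. w i * exp (- (y * q i)))"
      using finJ by simp
    also have "\<dots> = (\<Sum>a'\<in>q ` J. \<Sum>i | i \<in> J \<and> q i = a'. w i * exp (- (y * q i)))"
      using finJ by (rule sum.image_gen)
    also have "\<dots> = (\<Sum>a'\<in>q ` J. level_weight I q w a' * exp (- (y * a')))"
    proof (rule sum.cong[OF refl])
      fix a' assume "a' \<in> q ` J"
      then have "{i. i \<in> J \<and> q i = a'} = {i. i \<in> I \<and> q i = a'}" by (auto simp: J_def)
      then show "(\<Sum>i | i \<in> J \<and> q i = a'. w i * exp (- (y * q i))) = level_weight I q w a' * exp (- (y * a'))"
        by (simp add: level_weight_def sum_distrib_right)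
    qed
    also have "\<dots> = (\<Sum>a'\<in>q ` J. if a' = a then level_weight I q w a * exp (- (y * a)) else 0)"
      by (rule sum.cong[OF refl]) (auto simp: J_def intro!: lower)
    also have "\<dots> = level_weight I q w a * exp (- (y * a))"
    proof (cases "a \<in> q ` J")
      case True then show ?thesis using finJ by simp
    next
      case False
      then have "{i. i \<in> I \<and> q i = a} = {}" by (auto simp: J_def)
      then have "level_weight I q w a = 0" unfolding level_weight_def by (simp only: sum.empty)
      then show ?thesis using finJ by simp
    qed
    finally show ?thesis by (simp add: distrib_left exp_minus)
  qed
  have "((\<lambda>y. level_weight I q w a + exp (y * a) * (\<Sum>\<^sub>\<infinity>i\<in>K. w i * exp (- (y * q i))))
          \<longlongrightarrow> level_weight I q w a + 0) at_top"
    by (intro tendsto_add tendsto_const tail_tendsto_0[OF wK b(2,1)])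
  then have lim: "((\<lambda>y. level_weight I q w a + exp (y * a) * (\<Sum>\<^sub>\<infinity>i\<in>K. w i * exp (- (y * q i))))
          \<longlongrightarrow> level_weight I q w a) at_top" by simp
  show ?thesis
    by (rule Lim_transform_eventually[OF lim], rule eventually_mono[OF eventually_gt_at_top[of 0]])
       (simp add: split)
qed

lemma least_nonzero_level:
  assumes fin: "\<And>C. finite {i \<in> I. q i \<le> C}" and "level_weight I q w a \<noteq> 0"
  obtains a0 where "level_weight I q w a0 \<noteq> 0" "\<And>a'. a' < a0 \<Longrightarrow> level_weight I q w a' = 0"
proof -
  define E where "E = {a' \<in> q ` {i \<in> I. q i \<le> a}. level_weight I q w a' \<noteq> 0}"
  have level: "a' \<in> q ` I" if "level_weight I q w a' \<noteq> 0" for a'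
  proof (rule ccontr)
    assume "a' \<notin> q ` I"
    then have "{i. i \<in> I \<and> q i = a'} = {}" by auto
    then show False using that unfolding level_weight_def by (simp only: sum.empty)
  qed
  have E: "finite E" unfolding E_def using fin by simp
  have aE: "a \<in> E" using assms(2) level[of a] by (auto simp: E_def)
  have "Min E \<in> E" using E aE by (intro Min_in) auto
  then have "level_weight I q w (Min E) \<noteq> 0" by (simp add: E_def)
  moreover have "level_weight I q w a' = 0" if "a' < Min E" for a'
  proof (rule ccontr)
    assume nz: "level_weight I q w a' \<noteq> 0"
    have "Min E \<le> a" using E aE by simp
    then have "a' \<in> E" using nz level[OF nz] that by (auto simp: E_def)
    then show False using E that by (meson Min_le not_less)
  qed
  ultimately show ?thesis by (rule that)
qed

text \<open>
  Otherwise there is a lowest level of nonzero weight, and its weight is the limit of a rescaling of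
  the zero function.
\<close>

lemma level_weights_determined:
  assumes w: "heat_summable I q w" and fin: "\<And>C. finite {i \<in> I. q i \<le> C}"
    and zero: "\<And>y. 0 < y \<Longrightarrow> (\<Sum>\<^sub>\<infinity>i\<in>I. w i * exp (- (y * q i))) = 0"
  shows "level_weight I q w a = 0"
proof (rule ccontr)
  assume "level_weight I q w a \<noteq> 0"
  with fin obtain a0 where a0: "level_weight I q w a0 \<noteq> 0"
      "\<And>a'. a' < a0 \<Longrightarrow> level_weight I q w a' = 0"
    by (rule least_nonzero_level) blast
  have "((\<lambda>y. exp (y * a0) * (\<Sum>\<^sub>\<infinity>i\<in>I. w i * exp (- (y * q i)))) \<longlongrightarrow> 0) at_top"
    by (rule tendsto_eventually, rule eventually_mono[OF eventually_gt_at_top[of 0]]) (simp add: zero)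
  with leading_term_tendsto[OF w fin a0(2)] have "level_weight I q w a0 = 0"
    by (intro tendsto_unique[of "at_top :: real filter"]) auto
  with a0(1) show False ..
qed

section \<open>Theta series in the upper half plane\<close>

definition theta_series :: "'i set \<Rightarrow> ('i \<Rightarrow> real) \<Rightarrow> ('i \<Rightarrow> real) \<Rightarrow> complex \<Rightarrow> complex" where
  "theta_series I q w z =
     (\<Sum>\<^sub>\<infinity>i\<in>I. of_real (w i) * exp (2 * of_real pi * \<i> * of_real (q i) * z))"

lemma norm_theta_term:
  "norm (of_real c * exp (2 * of_real pi * \<i> * of_real t * z) :: complex)
     = \<bar>c\<bar> * exp (- (2 * pi * Im z * t))"
  by (simp add: norm_mult)

text \<open>
  The partial sums converge uniformly on a closed disc in the upper half plane, so by the
  Weierstrass theorem their derivatives converge to the derivative of the sum.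
\<close>

lemma ddz_theta_series:
  assumes w: "heat_summable I q w" and q: "\<And>i. i \<in> I \<Longrightarrow> 0 \<le> q i" and z: "0 < Im z"
  shows "ddz (theta_series I q w) z = theta_series I q (\<lambda>i. w i * q i) z"
proof -
  define r where "r = Im z / 2"
  define c where "c = 2 * of_real pi * \<i>"
  have c: "c \<noteq> 0" by (simp add: c_def)
  have r: "0 < r" using z by (simp add: r_def)
  have Im: "r \<le> Im x" if "x \<in> cball z r" for x
  proof -
    have "\<bar>Im (z - x)\<bar> \<le> r"
      using that abs_Im_le_cmod[of "z - x"] by (simp add: dist_norm)
    then have "\<bar>Im z - Im x\<bar> \<le> Im z / 2" by (simp add: r_def)
    then show ?thesis unfolding r_def by linarith
  qed
  define t where "t = (\<lambda>i x. of_real (w i) * exp (c * of_real (q i) * x))"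
  have "uniform_limit (cball z r) (\<lambda>X x. \<Sum>i\<in>X. t i x) (\<lambda>x. \<Sum>\<^sub>\<infinity>i\<in>I. t i x) (finite_subsets_at_top I)"
  proof (rule Weierstrass_m_test_general)
    show "(\<lambda>i. \<bar>w i\<bar> * exp (- (2 * pi * r * q i))) summable_on I"
      by (intro heat_summable_abs[OF w]) (use r in simp)
    fix i x assume i: "i \<in> I" and x: "x \<in> cball z r"
    have "2 * pi * r * q i \<le> 2 * pi * Im x * q i"
      using Im[OF x] q[OF i] by (intro mult_right_mono mult_left_mono) auto
    then show "norm (t i x) \<le> \<bar>w i\<bar> * exp (- (2 * pi * r * q i))"
      unfolding t_def c_def norm_theta_term by (intro mult_left_mono) auto
  qed
  moreover have "eventually (\<lambda>X. continuous_on (cball z r) (\<lambda>x. \<Sum>i\<in>X. t i x) \<and>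
      (\<forall>x\<in>ball z r. ((\<lambda>x. \<Sum>i\<in>X. t i x) has_field_derivative (\<Sum>i\<in>X. t i x * (c * of_real (q i)))) (at x)))
      (finite_subsets_at_top I)"
    unfolding t_def
    by (intro always_eventually allI conjI ballI)
       (auto intro!: continuous_intros derivative_eq_intros sum.cong simp: mult_ac)
  ultimately obtain g' where g': "\<And>x. x \<in> ball z r \<Longrightarrow>
      ((\<lambda>x. \<Sum>\<^sub>\<infinity>i\<in>I. t i x) has_field_derivative g' x) (at x) \<and>
      ((\<lambda>X. \<Sum>i\<in>X. t i x * (c * of_real (q i))) \<longlongrightarrow> g' x) (finite_subsets_at_top I)"
    using r by (elim has_complex_derivative_uniform_limit) auto
  have zr: "z \<in> ball z r" using r by simp
  have th: "theta_series I q w = (\<lambda>x. \<Sum>\<^sub>\<infinity>i\<in>I. t i x)"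
    by (simp add: theta_series_def t_def c_def fun_eq_iff)
  have "deriv (theta_series I q w) z = g' z"
    unfolding th using g'[OF zr] by (intro DERIV_imp_deriv) auto
  also have "\<dots> = (\<Sum>\<^sub>\<infinity>i\<in>I. t i z * (c * of_real (q i)))"
    using g'[OF zr] by (intro infsumI[symmetric]) (simp add: has_sum_def)
  also have "\<dots> = (\<Sum>\<^sub>\<infinity>i\<in>I. c * (of_real (w i * q i) * exp (c * of_real (q i) * z)))"
    by (simp add: t_def mult_ac)
  also have "\<dots> = c * theta_series I q (\<lambda>i. w i * q i) z"
    unfolding theta_series_def c_def[symmetric] by (rule infsum_cmult_right')
  finally show ?thesis
    using c by (simp add: ddz_def flip: c_def)
qed

lemma ddz_power_theta_series:
  assumes w: "heat_summable I q w" and q: "\<And>i. i \<in> I \<Longrightarrow> 0 \<le> q i" and z: "0 < Im z"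
  shows "(ddz ^^ k) (theta_series I q w) z = theta_series I q (\<lambda>i. w i * q i ^ k) z"
  using z
proof (induction k arbitrary: z)
  case (Suc k)
  have "eventually (\<lambda>x. x \<in> {x. 0 < Im x}) (nhds z)"
    using Suc.prems by (intro eventually_nhds_in_open open_halfspace_Im_gt) auto
  then have "eventually (\<lambda>x. (ddz ^^ k) (theta_series I q w) x = theta_series I q (\<lambda>i. w i * q i ^ k) x) (nhds z)"
    by (rule eventually_mono) (use Suc.IH in auto)
  then have "ddz ((ddz ^^ k) (theta_series I q w)) z = ddz (theta_series I q (\<lambda>i. w i * q i ^ k)) z"
    unfolding ddz_def by (simp add: deriv_cong_ev)
  also have "\<dots> = theta_series I q (\<lambda>i. w i * q i ^ k * q i) z"
    by (intro ddz_theta_series heat_summable_times_exponent_power w q Suc.prems)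
  finally show ?case by (simp add: mult_ac)
qed simp

lemma theta_series_imaginary_axis:
  assumes w: "heat_summable I q w" and y: "0 < y"
  shows "theta_series I q w (\<i> * of_real (y / (2 * pi)))
           = of_real (\<Sum>\<^sub>\<infinity>i\<in>I. w i * exp (- (y * q i)))"
proof -
  have "((\<lambda>i. of_real (w i * exp (- (y * q i))) :: complex) has_sum
      of_real (\<Sum>\<^sub>\<infinity>i\<in>I. w i * exp (- (y * q i)))) I"
    by (intro has_sum_of_real has_sum_infsum heat_summable_sum[OF w y])
  moreover have "of_real (w i) * exp (2 * of_real pi * \<i> * of_real (q i) * (\<i> * of_real (y / (2 * pi))))
      = (of_real (w i * exp (- (y * q i))) :: complex)" for i
  proof -
    have "2 * of_real pi * \<i> * of_real (q i) * (\<i> * of_real (y / (2 * pi))) = (of_real (- (y * q i)) :: complex)"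
      by (simp add: complex_eq_iff)
    then show ?thesis by (simp flip: exp_of_real)
  qed
  ultimately show ?thesis
    unfolding theta_series_def by (simp only: infsumI)
qed

section \<open>Gaussian sums over the integer lattice\<close>

lemma sum_int_gaussian_le:
  assumes c: "0 < c"
  shows "(\<Sum>k\<in>{- int N..int N}. exp (- c * (of_int k)\<^sup>2)) \<le> 2 / (1 - exp (- c) :: real)"
proof -
  have "(\<Sum>k\<in>{- int N..int N}. exp (- c * (of_int k)\<^sup>2)) \<le> 2 * (\<Sum>j\<le>N. exp (- c) ^ j)"
  proof (induction N)
    case (Suc N)
    have *: "{- int (Suc N)..int (Suc N)} = insert (int (Suc N)) (insert (- int (Suc N)) {- int N..int N})"
      by auto
    have "c * real (Suc N) \<le> c * (real (Suc N))\<^sup>2"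
      using c by (intro mult_left_mono) (simp_all add: power2_eq_square)
    then have "exp (- c * (real (Suc N))\<^sup>2) \<le> exp (- c) ^ Suc N"
      unfolding exp_of_nat_mult[symmetric] by (simp only: exp_le_cancel_iff) (simp add: mult.commute)
    moreover have "(- 1 - real N)\<^sup>2 = (1 + real N)\<^sup>2"
      by (simp add: power2_eq_square algebra_simps)
    ultimately show ?case
      using Suc unfolding * by simp
  qed simp
  also have "(\<Sum>j\<le>N. exp (- c) ^ j) \<le> (\<Sum>j. exp (- c) ^ j)"
    using c by (intro sum_le_suminf summable_geometric) auto
  also have "\<dots> = 1 / (1 - exp (- c))"
    using c by (intro suminf_geometric) auto
  finally show ?thesis by simp
qed

text \<open>
  A finite set of integer vectors lies in a cube, over which the Gaussian sum is a product of
  one-dimensional sums, each bounded independently of the side of the cube.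
\<close>

lemma gaussian_summable_int_vectors:
  assumes c: "0 < c"
  shows "(\<lambda>x :: real^'n. exp (- c * (norm x)\<^sup>2)) summable_on int_vectors"
proof (rule nonneg_bdd_above_summable_on)
  show "bdd_above (sum (\<lambda>x :: real^'n. exp (- c * (norm x)\<^sup>2)) ` {F. F \<subseteq> int_vectors \<and> finite F})"
  proof (rule bdd_aboveI2)
    fix F :: "(real^'n) set" assume "F \<in> {F. F \<subseteq> int_vectors \<and> finite F}"
    then have F: "F \<subseteq> int_vectors" "finite F" by auto
    define \<phi> :: "('n \<Rightarrow> int) \<Rightarrow> real^'n" where "\<phi> = (\<lambda>g. \<chi> i. of_int (g i))"
    define N where "N = nat (\<Sum>x\<in>F. \<Sum>i\<in>UNIV. \<lfloor>\<bar>x $ i\<bar>\<rfloor>)"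
    define B where "B = (\<Pi>\<^sub>E i\<in>(UNIV :: 'n set). {- int N..int N})"
    have finB: "finite B" unfolding B_def by (intro finite_PiE) auto
    have inj: "inj_on \<phi> B" by (auto simp: inj_on_def \<phi>_def vec_eq_iff)
    have "F \<subseteq> \<phi> ` B"
    proof
      fix x assume x: "x \<in> F"
      define g where "g = (\<lambda>i. \<lfloor>x $ i\<rfloor>)"
      have Z: "x $ i \<in> \<int>" for i using F(1) x by (auto simp: int_vectors_def)
      then have xg: "x $ i = of_int (g i)" for i by (simp add: g_def)
      have "\<bar>g i\<bar> \<le> int N" for i
      proof -
        have "\<bar>g i\<bar> = \<lfloor>\<bar>x $ i\<bar>\<rfloor>" using xg[of i] by (metis floor_of_int of_int_abs)
        also have "\<dots> \<le> (\<Sum>i\<in>UNIV. \<lfloor>\<bar>x $ i\<bar>\<rfloor>)" by (rule member_le_sum) auto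
        also have "\<dots> \<le> (\<Sum>x\<in>F. \<Sum>i\<in>UNIV. \<lfloor>\<bar>x $ i\<bar>\<rfloor>)"
          using x F(2) by (intro member_le_sum sum_nonneg) auto
        finally show ?thesis unfolding N_def by (rule order_trans) simp
      qed
      then have "g \<in> B" by (auto simp: B_def abs_le_iff minus_le_iff)
      moreover have "x = \<phi> g" by (simp add: \<phi>_def vec_eq_iff xg)
      ultimately show "x \<in> \<phi> ` B" by blast
    qed
    then have "sum (\<lambda>x. exp (- c * (norm x)\<^sup>2)) F \<le> sum (\<lambda>x. exp (- c * (norm x)\<^sup>2)) (\<phi> ` B)"
      using finB by (intro sum_mono2) auto
    also have "\<dots> = (\<Sum>g\<in>B. exp (- c * (norm (\<phi> g))\<^sup>2))"
      using inj by (simp add: sum.reindex)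
    also have "\<dots> = (\<Sum>g\<in>B. \<Prod>i\<in>UNIV. exp (- c * (of_int (g i))\<^sup>2))"
    proof (rule sum.cong[OF refl])
      fix g
      have "(norm (\<phi> g))\<^sup>2 = (\<Sum>i\<in>UNIV. (of_int (g i))\<^sup>2)"
        unfolding power2_norm_eq_inner inner_vec_def by (simp add: \<phi>_def power2_eq_square)
      then show "exp (- c * (norm (\<phi> g))\<^sup>2) = (\<Prod>i\<in>UNIV. exp (- c * (of_int (g i))\<^sup>2))"
        by (simp only: sum_distrib_left exp_sum[OF finite_class.finite_UNIV])
    qed
    also have "\<dots> = (\<Prod>i\<in>(UNIV :: 'n set). \<Sum>k\<in>{- int N..int N}. exp (- c * (of_int k)\<^sup>2))"
      unfolding B_def by (rule prod_sum_PiE[symmetric]) auto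
    also have "\<dots> \<le> (\<Prod>i\<in>(UNIV :: 'n set). 2 / (1 - exp (- c)))"
      using sum_int_gaussian_le[OF c] by (intro prod_mono) (auto intro: sum_nonneg)
    finally show "sum (\<lambda>x. exp (- c * (norm x)\<^sup>2)) F \<le> (\<Prod>i\<in>(UNIV :: 'n set). 2 / (1 - exp (- c)))" .
  qed
qed auto

lemma heat_summable_int_vectors:
  fixes q :: "real^'n \<Rightarrow> real"
  assumes c: "0 < c" and q: "\<And>x. c * (norm x)\<^sup>2 \<le> q x"
  shows "heat_summable int_vectors q (\<lambda>_. 1)"
  unfolding heat_summable_def
proof (intro allI impI)
  fix y :: real assume y: "0 < y"
  have "(\<lambda>x :: real^'n. exp (- (y * c) * (norm x)\<^sup>2)) summable_on int_vectors"
    using c y by (intro gaussian_summable_int_vectors) simp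
  then show "(\<lambda>x. \<bar>1\<bar> * exp (- (y * q x))) summable_on int_vectors"
  proof (rule summable_on_comparison_test)
    fix x
    have "y * (c * (norm x)\<^sup>2) \<le> y * q x" using y q by (intro mult_left_mono) auto
    then show "\<bar>1\<bar> * exp (- (y * q x)) \<le> exp (- (y * c) * (norm x)\<^sup>2)" by (simp add: mult_ac)
  qed auto
qed

section \<open>Positive definite forms and their values on integer vectors\<close>

lemma quad_form_add: "quad_form (A + B) x = quad_form A x + quad_form B x"
  by (simp add: quad_form_def matrix_vector_mult_add_rdistrib inner_right_distrib)

lemma quad_form_scaleR: "quad_form (t *\<^sub>R A) x = t * quad_form A x"
  by (simp add: quad_form_def flip: scaleR_matrix_vector_assoc)

lemma quad_form_diff: "quad_form (A - B) x = quad_form A x - quad_form B x"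
  using quad_form_add[of "A - B" B x] by simp

lemma quad_form_scaleR_vec: "quad_form A (t *\<^sub>R x) = t\<^sup>2 * quad_form A x"
  by (simp add: quad_form_def matrix_vector_mult_scaleR power2_eq_square)

lemma quad_form_minus [simp]: "quad_form A (- x) = quad_form A x"
  using quad_form_scaleR_vec[of A "-1" x] by simp

lemma quad_form_transpose_mult: "quad_form (transpose Q ** H ** Q) x = quad_form H (Q *v x)"
proof -
  have "quad_form (transpose Q ** H ** Q) x = inner x (transpose Q *v (H *v (Q *v x)))"
    by (simp add: quad_form_def matrix_vector_mul_assoc matrix_mul_assoc)
  also have "\<dots> = inner (Q *v x) (H *v (Q *v x))"
    by (metis dot_lmul_matrix inner_commute matrix_vector_mul_lid transpose_matrix_vector
        transpose_transpose)
  finally show ?thesis by (simp add: quad_form_def)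
qed

lemma quad_form_gram: "quad_form (transpose Q ** Q) x = (norm (Q *v x))\<^sup>2"
  using quad_form_transpose_mult[of Q "mat 1" x] by (simp add: quad_form_def power2_norm_eq_inner)

text \<open>
  The norm on matrices is the Frobenius norm, so this is the Cauchy-Schwarz inequality in each
  row.
\<close>

lemma norm_matrix_vector_le:
  fixes D :: "real^'n^'m"
  shows "norm (D *v x) \<le> norm D * norm x"
proof (rule power2_le_imp_le)
  have n: "(norm v)\<^sup>2 = (\<Sum>i\<in>UNIV. (norm (v $ i))\<^sup>2)" for v :: "'b::real_normed_vector^'m"
    by (simp add: norm_vec_def L2_set_def sum_nonneg)
  have "(norm (D *v x))\<^sup>2 = (\<Sum>i\<in>UNIV. (inner (D $ i) x)\<^sup>2)"
    by (simp add: n matrix_vector_mul_component)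
  also have "\<dots> \<le> (\<Sum>i\<in>UNIV. (norm (D $ i) * norm x)\<^sup>2)"
    by (intro sum_mono abs_le_square_iff[THEN iffD1]) (simp add: Cauchy_Schwarz_ineq2)
  also have "\<dots> = (norm D * norm x)\<^sup>2"
    by (simp add: power_mult_distrib n[of D] sum_distrib_right)
  finally show "(norm (D *v x))\<^sup>2 \<le> (norm D * norm x)\<^sup>2" .
qed simp

lemma abs_quad_form_le: "\<bar>quad_form D x\<bar> \<le> norm D * (norm x)\<^sup>2"
proof -
  have "\<bar>quad_form D x\<bar> \<le> norm x * norm (D *v x)"
    unfolding quad_form_def by (rule Cauchy_Schwarz_ineq2)
  also have "\<dots> \<le> norm x * (norm D * norm x)"
    by (intro mult_left_mono norm_matrix_vector_le) simp
  finally show ?thesis by (simp add: power2_eq_square mult_ac)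
qed

text \<open>
  The constant is the minimum of the form on the unit sphere.
\<close>

lemma Quad_pos_coercive:
  assumes "A \<in> Quad_pos"
  obtains c where "0 < c" "\<And>x. c * (norm x)\<^sup>2 \<le> quad_form A x"
proof -
  have ne: "sphere (0 :: real^'n) 1 \<noteq> {}"
    by (simp add: sphere_eq_empty)
  have "continuous_on (sphere 0 1) (quad_form A)"
    unfolding quad_form_def by (intro continuous_intros matrix_vector_mult_linear_continuous_on)
  then obtain u where u: "u \<in> sphere 0 1" "\<And>x. x \<in> sphere 0 1 \<Longrightarrow> quad_form A u \<le> quad_form A x"
    using continuous_attains_inf[OF compact_sphere ne] by metis
  show ?thesis
  proof (rule that[of "quad_form A u"])
    have "u \<noteq> 0" using u(1) by auto
    then show "0 < quad_form A u" using assms by (simp add: Quad_pos_def)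
    show "quad_form A u * (norm x)\<^sup>2 \<le> quad_form A x" for x
    proof (cases "x = 0")
      case False
      have "quad_form A u * (norm x)\<^sup>2 \<le> quad_form A (x /\<^sub>R norm x) * (norm x)\<^sup>2"
        using False by (intro mult_right_mono u(2)) auto
      also have "\<dots> = quad_form A x"
        using False by (simp add: quad_form_scaleR_vec power2_eq_square field_simps)
      finally show ?thesis .
    qed (simp add: quad_form_def)
  qed
qed

lemma Quad_pos_coercive_nearby:
  assumes "A \<in> Quad_pos"
  obtains d c where "0 < d" "0 < c" "\<And>B x. B \<in> ball A d \<Longrightarrow> c * (norm x)\<^sup>2 \<le> quad_form B x"
proof -
  obtain c where c: "0 < c" "\<And>x. c * (norm x)\<^sup>2 \<le> quad_form A x"
    using Quad_pos_coercive[OF assms] by blast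
  show ?thesis
  proof (rule that[of "c / 2" "c / 2"])
    fix B x assume B: "B \<in> ball A (c / 2)"
    have "quad_form A x - quad_form B x \<le> norm (A - B) * (norm x)\<^sup>2"
      using abs_quad_form_le[of "A - B" x] by (simp add: quad_form_diff)
    also have "\<dots> \<le> c / 2 * (norm x)\<^sup>2"
      using B by (intro mult_right_mono) (auto simp: dist_norm)
    finally show "c / 2 * (norm x)\<^sup>2 \<le> quad_form B x"
      using c(2)[of x] by simp
  qed (use c in auto)
qed

lemma finite_int_vectors_bounded: "finite {x \<in> int_vectors :: (real^'n) set. (norm x)\<^sup>2 \<le> R}"
  by (rule finite_exponents_below, rule heat_summable_int_vectors[of 1]) auto

lemma countable_int_vectors: "countable (int_vectors :: (real^'n) set)"
proof -
  have "countable {x \<in> int_vectors :: (real^'n) set. exp (- 1 * (norm x)\<^sup>2) \<noteq> 0}"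
    by (intro summable_countable_real gaussian_summable_int_vectors) simp
  then show ?thesis by simp
qed

text \<open>
  The case \<open>i = j\<close> gives \<open>2 e\<^sub>i\<close>. The values of a form at \<open>2 e\<^sub>i\<close>, \<open>2 e\<^sub>j\<close> and \<open>e\<^sub>i + e\<^sub>j\<close> give the entries
  \<open>(i, i)\<close>, \<open>(j, j)\<close> and \<open>(i, j)\<close> of its matrix.
\<close>

definition test_vectors :: "(real^'n) set" where
  "test_vectors = {axis i 1 + axis j 1 | i j. True}"

lemma finite_test_vectors: "finite (test_vectors :: (real^'n) set)"
proof -
  have "test_vectors = (\<lambda>(i, j). axis i 1 + axis j 1 :: real^'n) ` UNIV"
    by (auto simp: test_vectors_def image_def)
  then show ?thesis by (metis finite finite_imageI)
qed

lemma test_vectors_int: "test_vectors \<subseteq> int_vectors"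
  by (auto simp: test_vectors_def int_vectors_def axis_def)

lemma test_vectors_nonzero: "l \<in> test_vectors \<Longrightarrow> l \<noteq> 0"
  by (auto simp: test_vectors_def axis_def vec_eq_iff)

lemma norm_test_vectors: "l \<in> test_vectors \<Longrightarrow> (norm l)\<^sup>2 \<le> 4"
proof -
  assume "l \<in> test_vectors"
  then obtain i j where l: "l = axis i 1 + axis j 1" by (auto simp: test_vectors_def)
  have "norm l \<le> 2"
    unfolding l using norm_triangle_ineq[of "axis i 1" "axis j (1::real)"] by (simp add: norm_axis_1)
  then show "(norm l)\<^sup>2 \<le> 4"
    using power_mono[of "norm l" 2 2] by simp
qed

lemma symmetric_zero_if_zero_on_test_vectors:
  fixes B :: "real^'n^'n"
  assumes sym: "transpose B = B" and zero: "\<And>l. l \<in> test_vectors \<Longrightarrow> quad_form B l = 0"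
  shows "B = 0"
proof -
  have B: "B $ i $ i + B $ j $ j + 2 * B $ i $ j = 0" for i j
  proof -
    have "B $ j $ i = B $ i $ j"
      using sym by (metis transpose_def vec_lambda_beta)
    moreover have "quad_form B (axis i 1 + axis j 1) = 0"
      by (intro zero) (auto simp: test_vectors_def)
    ultimately show ?thesis
      by (simp add: quad_form_def matrix_vector_right_distrib matrix_vector_mult_basis
          inner_add_left inner_axis' column_def)
  qed
  have "B $ i $ i = 0" for i using B[of i i] by simp
  then have "B $ i $ j = 0" for i j using B[of i j] by simp
  then show ?thesis by (simp add: vec_eq_iff)
qed

section \<open>Generic forms\<close>

text \<open>
  Only the finitely many test vectors are required to be alone on their level: requiring this of
  all integer vectors would give a dense set that need not be open.
\<close>

definition generic_forms :: "(real^'n^'n) set" where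
  "generic_forms = {A \<in> Quad_pos. \<forall>l\<in>test_vectors. \<forall>m\<in>int_vectors.
     quad_form A m = quad_form A l \<longrightarrow> m = l \<or> m = - l}"

text \<open>
  The two forms \<open>B\<close> and \<open>B'\<close> are independent of each other: \<open>B = B'\<close> gives openness of the set of
  generic forms, and the general case gives local injectivity of the theta map. All relevant \<open>m\<close>
  are bounded by coercivity near \<open>A\<close>, so that only finitely many differences
  \<open>A(m) - A(l) \<noteq> 0\<close> have to survive a small perturbation.
\<close>

lemma generic_forms_isolated:
  fixes A :: "real^'n^'n"
  assumes A: "A \<in> generic_forms"
  obtains d where "0 < d"
    "\<And>B B' l m. B \<in> ball A d \<Longrightarrow> B' \<in> ball A d \<Longrightarrow> l \<in> test_vectors \<Longrightarrow> m \<in> int_vectors \<Longrightarrow>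
       quad_form B' m = quad_form B l \<Longrightarrow> m = l \<or> m = - l"
proof -
  have pos: "A \<in> Quad_pos" using A by (simp add: generic_forms_def)
  obtain d1 c where d1: "0 < d1" and c: "0 < c"
    and coer: "\<And>B x. B \<in> ball A d1 \<Longrightarrow> c * (norm x)\<^sup>2 \<le> quad_form B x"
    by (rule Quad_pos_coercive_nearby[OF pos]) blast
  \<comment> \<open>If \<open>B(m)\<close> is the value at a test vector of a form near \<open>A\<close>, then \<open>\<parallel>m\<parallel>\<^sup>2 \<le> R\<close>: test vectors have
      squared norm at most \<open>4\<close>.\<close>
  define R where "R = (norm A + d1) * 4 / c"
  have R: "0 \<le> R" using c d1 by (simp add: R_def)
  define F where "F = {m \<in> int_vectors :: (real^'n) set. (norm m)\<^sup>2 \<le> R}"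
  define P where "P = {(l, m). l \<in> test_vectors \<and> m \<in> F \<and> m \<noteq> l \<and> m \<noteq> - l}"
  \<comment> \<open>The element \<open>1\<close> keeps the set nonempty.\<close>
  define gaps where "gaps = insert 1 ((\<lambda>(l, m). \<bar>quad_form A m - quad_form A l\<bar>) ` P)"
  have "finite F" unfolding F_def by (rule finite_int_vectors_bounded)
  then have "finite P"
    using finite_test_vectors by (intro finite_subset[of P "test_vectors \<times> F"]) (auto simp: P_def)
  then have gaps: "finite gaps" "gaps \<noteq> {}" by (auto simp: gaps_def)
  have "0 < g" if "g \<in> gaps" for g
    using that A by (auto simp: gaps_def P_def F_def generic_forms_def) blast
  then have gap_pos: "0 < Min gaps" using gaps by (simp add: Min_gr_iff)
  \<comment> \<open>The two values together move by at most \<open>d (R + 4)\<close>, which has to stay strictly below the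
      smallest gap.\<close>
  define d where "d = min d1 (Min gaps / (R + 5))"
  show ?thesis
  proof (rule that[of d])
    show "0 < d" using d1 gap_pos R by (simp add: d_def)
  next
    fix B B' :: "real^'n^'n" and l m :: "real^'n"
    assume B: "B \<in> ball A d" and B': "B' \<in> ball A d"
      and l: "l \<in> test_vectors" and m: "m \<in> int_vectors"
      and eq: "quad_form B' m = quad_form B l"
    have close: "\<bar>quad_form C x - quad_form A x\<bar> \<le> d * (norm x)\<^sup>2" if "C \<in> ball A d" for C x
    proof -
      have "\<bar>quad_form C x - quad_form A x\<bar> \<le> norm (C - A) * (norm x)\<^sup>2"
        using abs_quad_form_le[of "C - A" x] by (simp add: quad_form_diff)
      also have "\<dots> \<le> d * (norm x)\<^sup>2"
        using that by (intro mult_right_mono) (auto simp: dist_norm norm_minus_commute)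
      finally show ?thesis .
    qed
    have "c * (norm m)\<^sup>2 \<le> quad_form B' m"
      using B' by (intro coer) (simp add: d_def)
    also have "\<dots> \<le> norm B * (norm l)\<^sup>2"
      unfolding eq using abs_quad_form_le[of B l] by simp
    also have "\<dots> \<le> (norm A + d1) * 4"
    proof (rule mult_mono)
      have "norm B \<le> norm A + norm (B - A)" by (rule norm_triangle_sub)
      then show "norm B \<le> norm A + d1"
        using B by (simp add: d_def dist_norm norm_minus_commute)
    qed (use norm_test_vectors[OF l] d1 in auto)
    finally have mR: "(norm m)\<^sup>2 \<le> R" using c by (simp add: R_def field_simps)
    show "m = l \<or> m = - l"
    proof (rule ccontr)
      assume "\<not> (m = l \<or> m = - l)"
      then have "\<bar>quad_form A m - quad_form A l\<bar> \<in> gaps"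
        using l m mR by (force simp: gaps_def P_def F_def)
      then have "Min gaps \<le> \<bar>quad_form A m - quad_form A l\<bar>" using gaps by simp
      also have "\<dots> \<le> \<bar>quad_form B' m - quad_form A m\<bar> + \<bar>quad_form B l - quad_form A l\<bar>"
        using eq by linarith
      also have "\<dots> \<le> d * (norm m)\<^sup>2 + d * (norm l)\<^sup>2"
        by (intro add_mono close B B')
      finally have 1: "Min gaps \<le> d * ((norm m)\<^sup>2 + (norm l)\<^sup>2)" by (simp add: distrib_left)
      also have "\<dots> \<le> Min gaps / (R + 5) * (R + 4)"
        using mR norm_test_vectors[OF l] gap_pos R by (intro mult_mono) (auto simp: d_def)
      also have "\<dots> < Min gaps" using gap_pos R by (simp add: field_simps)
      finally show False by simp
    qed
  qed
qed

text \<open>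
  Hyperplanes are null sets, and countably many of them do not cover the space.
\<close>

lemma exists_vector_not_orthogonal:
  fixes W :: "(real^'n) set"
  assumes "countable W" "0 \<notin> W"
  obtains v where "\<And>w. w \<in> W \<Longrightarrow> inner w v \<noteq> 0"
proof -
  have "(\<Union>w\<in>W. {v. inner w v = 0}) \<in> null_sets lebesgue"
  proof (rule null_sets_UN'[OF assms(1)])
    fix w assume "w \<in> W"
    then have "w \<noteq> 0" using assms(2) by auto
    then show "{v. inner w v = 0} \<in> null_sets lebesgue"
      using negligible_hyperplane[of w 0] by (simp add: negligible_iff_null_sets)
  qed
  then have "(\<Union>w\<in>W. {v. inner w v = 0}) \<noteq> UNIV"
    by (metis negligible_iff_null_sets non_negligible_UNIV)
  then show ?thesis using that by blast
qed

lemma quad_form_outer: "quad_form (\<chi> i j. v $ i * v $ j) x = (inner x v)\<^sup>2"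
  by (simp add: quad_form_def inner_vec_def matrix_vector_mult_def power2_eq_square
      sum_distrib_left sum_distrib_right mult_ac)

text \<open>
  Perturb \<open>A\<close> to \<open>A + t v v\<^sup>T\<close> with \<open>t > 0\<close>, which is again positive definite. The form \<open>v v\<^sup>T\<close> takes the value
  \<open>(v \<bullet> x)\<^sup>2\<close> at \<open>x\<close>; if \<open>v\<close> is not orthogonal to any nonzero integer vector, this separates all
  integer vectors up to sign, and every coincidence of two values excludes at most one \<open>t\<close>.
\<close>

lemma generic_forms_dense:
  fixes A :: "real^'n^'n"
  assumes A: "A \<in> Quad_pos" and e: "0 < e"
  obtains B where "B \<in> generic_forms" "dist B A < e"
proof -
  let ?Z = "int_vectors :: (real^'n) set"
  define W where "W = (\<lambda>(l, m). m - l) ` (?Z \<times> ?Z) \<union> (\<lambda>(l, m). m + l) ` (?Z \<times> ?Z) - {0}"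
  have cZ: "countable (?Z \<times> ?Z)"
    by (intro countable_SIGMA countable_int_vectors)
  then have "countable W" by (auto simp: W_def intro!: countable_Diff)
  then obtain v where v: "\<And>w. w \<in> W \<Longrightarrow> inner w v \<noteq> 0"
    by (rule exists_vector_not_orthogonal) (auto simp: W_def)
  define D where "D = (\<chi> i j. v $ i * v $ j)"
  have D: "quad_form D m \<noteq> quad_form D l" if "m \<in> ?Z" "l \<in> ?Z" "m \<noteq> l" "m \<noteq> - l" for l m
  proof -
    have "m - l \<in> W" "m + l \<in> W"
      using that by (force simp: W_def add_eq_0_iff2)+
    then have "inner (m - l) v \<noteq> 0" "inner (m + l) v \<noteq> 0" by (auto dest: v)
    then show ?thesis
      by (simp add: D_def quad_form_outer power2_eq_iff inner_diff_left inner_add_left)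
  qed
  \<comment> \<open>The parameters \<open>t\<close> at which two of the values coincide. Pairs with \<open>m = \<plusminus>l\<close> contribute only
      \<open>0\<close>, since division by zero gives zero.\<close>
  define T where "T = (\<lambda>(l, m). (quad_form A l - quad_form A m) / (quad_form D m - quad_form D l)) ` (?Z \<times> ?Z)"
  have "countable T" using cZ by (simp add: T_def)
  define u where "u = e / (norm D + 1)"
  have u: "0 < u" using e by (simp add: u_def add_nonneg_pos)
  have "\<not> {0<..<u} \<subseteq> T"
    using \<open>countable T\<close> u countable_subset uncountable_open_interval by blast
  then obtain t where t: "0 < t" "t < u" "t \<notin> T"
    by (metis greaterThanLessThan_iff subsetI)
  define B where "B = A + t *\<^sub>R D"
  have qB: "quad_form B x = quad_form A x + t * quad_form D x" for x
    by (simp add: B_def quad_form_add quad_form_scaleR)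
  have "transpose B = B"
    using A by (simp add: B_def D_def Quad_pos_def transpose_def vec_eq_iff mult.commute)
  moreover have "0 < quad_form B x" if "x \<noteq> 0" for x
    using A that t(1) by (simp add: qB D_def quad_form_outer Quad_pos_def add_pos_nonneg)
  ultimately have "B \<in> Quad_pos" by (simp add: Quad_pos_def)
  moreover have "m = l \<or> m = - l" if "l \<in> test_vectors" "m \<in> ?Z" "quad_form B m = quad_form B l" for l m
  proof (rule ccontr)
    assume "\<not> (m = l \<or> m = - l)"
    then have ne: "quad_form D m - quad_form D l \<noteq> 0"
      using D[of m l] that test_vectors_int by auto
    have "t * (quad_form D m - quad_form D l) = quad_form A l - quad_form A m"
      using that(3) by (simp add: qB algebra_simps)
    then have "t = (quad_form A l - quad_form A m) / (quad_form D m - quad_form D l)"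
      using ne by (simp add: eq_divide_eq)
    then have "t \<in> T"
      using that test_vectors_int by (force simp: T_def)
    then show False using t(3) by simp
  qed
  ultimately have "B \<in> generic_forms" by (simp add: generic_forms_def)
  moreover have "dist B A < e"
  proof -
    have "dist B A = t * norm D" using t(1) by (simp add: B_def dist_norm)
    also have "\<dots> \<le> t * (norm D + 1)" using t(1) by simp
    also have "\<dots> < u * (norm D + 1)" using t by (intro mult_strict_right_mono) (auto simp: add_nonneg_pos)
    also have "\<dots> = e"
    proof -
      have "norm D + 1 \<noteq> 0" using norm_ge_zero[of D] by linarith
      then show ?thesis by (simp add: u_def)
    qed
    finally show ?thesis .
  qed
  ultimately show ?thesis by (rule that)
qed

lemma generically_generic_forms:
  assumes "\<And>A. A \<in> generic_forms \<Longrightarrow> P A"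
  shows "generically (Quad_pos :: (real^'n^'n) set) P"
  unfolding generically_def
proof (intro exI[of _ generic_forms] conjI ballI assms)
  show "openin (top_of_set Quad_pos) (generic_forms :: (real^'n^'n) set)"
    unfolding openin_contains_ball
  proof (intro conjI ballI)
    fix A :: "real^'n^'n" assume A: "A \<in> generic_forms"
    obtain d where "0 < d" and d: "\<And>B B' l m. B \<in> ball A d \<Longrightarrow> B' \<in> ball A d \<Longrightarrow> l \<in> test_vectors \<Longrightarrow>
        m \<in> int_vectors \<Longrightarrow> quad_form B' m = quad_form B l \<Longrightarrow> m = l \<or> m = - l"
      by (rule generic_forms_isolated[OF A]) blast
    have "ball A d \<inter> Quad_pos \<subseteq> generic_forms"
      unfolding generic_forms_def using d by blast
    then show "\<exists>e>0. ball A e \<inter> Quad_pos \<subseteq> generic_forms"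
      using \<open>0 < d\<close> by blast
  qed (auto simp: generic_forms_def)
  show "Quad_pos \<subseteq> closure (generic_forms :: (real^'n^'n) set)"
    by (auto simp: closure_approachable) (metis generic_forms_dense)
qed

section \<open>Local injectivity of the theta map\<close>

lemma heat_summable_quad_form:
  assumes "A \<in> Quad_pos"
  shows "heat_summable int_vectors (quad_form A) (\<lambda>_. 1)"
proof -
  obtain c where "0 < c" "\<And>x. c * (norm x)\<^sup>2 \<le> quad_form A x"
    by (rule Quad_pos_coercive[OF assms]) blast
  then show ?thesis by (rule heat_summable_int_vectors)
qed

lemma Theta_imaginary_axis:
  assumes A: "A \<in> Quad_pos" and y: "0 < y"
  shows "Theta A (\<i> * of_real (y / (2 * pi)))
           = of_real (\<Sum>\<^sub>\<infinity>l\<in>int_vectors. exp (- (y * quad_form A l)))"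
proof -
  have "\<i> * of_real (y / (2 * pi)) \<in> upper_half_plane"
    using y by (simp add: upper_half_plane_def)
  then have "Theta A (\<i> * of_real (y / (2 * pi)))
      = theta_series int_vectors (quad_form A) (\<lambda>_. 1) (\<i> * of_real (y / (2 * pi)))"
    by (simp add: Theta_def theta_series_def)
  also have "\<dots> = of_real (\<Sum>\<^sub>\<infinity>l\<in>int_vectors. 1 * exp (- (y * quad_form A l)))"
    by (rule theta_series_imaginary_axis[OF heat_summable_quad_form[OF A] y])
  finally show ?thesis by simp
qed

text \<open>
  The difference of the two theta functions is one exponential sum over two copies of the integer
  vectors, with weights \<open>1\<close> and \<open>-1\<close>. As it vanishes, all its level weights do, whereas a value taken by
  \<open>A\<close> alone would have positive weight.
\<close>

lemma Theta_eq_imp_same_values: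
  fixes A B :: "real^'n^'n"
  assumes A: "A \<in> Quad_pos" and B: "B \<in> Quad_pos" and eq: "Theta A = Theta B"
    and l: "l \<in> int_vectors"
  obtains m where "m \<in> int_vectors" "quad_form B m = quad_form A l"
proof -
  let ?Z = "int_vectors :: (real^'n) set"
  define q where "q = case_sum (quad_form A) (quad_form B)"
  define w :: "(real^'n) + (real^'n) \<Rightarrow> real" where "w = case_sum (\<lambda>_. 1) (\<lambda>_. - 1)"
  have Plus: "?Z <+> ?Z = Inl ` ?Z \<union> Inr ` ?Z" by (auto simp: Plus_def)
  have sum_A: "(\<lambda>l. exp (- (y * quad_form A l))) summable_on ?Z" and
    sum_B: "(\<lambda>l. exp (- (y * quad_form B l))) summable_on ?Z" if "0 < y" for y
    using heat_summable_sum[OF heat_summable_quad_form[OF A] that]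
      heat_summable_sum[OF heat_summable_quad_form[OF B] that] by simp_all
  have I1: "heat_summable (?Z <+> ?Z) q (\<lambda>_. 1)"
    unfolding heat_summable_def Plus
    by (intro allI impI summable_on_Un_disjoint)
       (auto simp: summable_on_reindex o_def q_def sum_A sum_B)
  have w: "heat_summable (?Z <+> ?Z) q w"
    by (rule heat_summable_comparison[OF I1, of _ 1]) (auto simp: w_def)
  have zero: "(\<Sum>\<^sub>\<infinity>i\<in>?Z <+> ?Z. w i * exp (- (y * q i))) = 0" if y: "0 < y" for y
  proof -
    have "(\<Sum>\<^sub>\<infinity>i\<in>?Z <+> ?Z. w i * exp (- (y * q i)))
        = (\<Sum>\<^sub>\<infinity>i\<in>Inl ` ?Z. w i * exp (- (y * q i))) + (\<Sum>\<^sub>\<infinity>i\<in>Inr ` ?Z. w i * exp (- (y * q i)))"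
      unfolding Plus
      by (intro infsum_Un_disjoint heat_summable_subset[OF w, THEN heat_summable_sum] y)
         (auto simp: Plus_def)
    also have "\<dots> = (\<Sum>\<^sub>\<infinity>l\<in>?Z. exp (- (y * quad_form A l))) - (\<Sum>\<^sub>\<infinity>l\<in>?Z. exp (- (y * quad_form B l)))"
      by (simp add: infsum_reindex o_def w_def q_def infsum_uminus)
    also have "(of_real \<dots> :: complex) = 0"
      using Theta_imaginary_axis[OF A y] Theta_imaginary_axis[OF B y] eq by simp
    finally show ?thesis by simp
  qed
  have "level_weight (?Z <+> ?Z) q w (quad_form A l) = 0"
    by (rule level_weights_determined[OF w finite_exponents_below[OF I1] zero])
  moreover have "level_weight (?Z <+> ?Z) q w (quad_form A l) > 0"
    if no: "\<And>m. m \<in> ?Z \<Longrightarrow> quad_form B m \<noteq> quad_form A l"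
    unfolding level_weight_def
  proof (rule sum_pos2)
    show "finite {i \<in> ?Z <+> ?Z. q i = quad_form A l}"
      using finite_exponents_below[OF I1, of "quad_form A l"] by (rule finite_subset[rotated]) auto
    show "Inl l \<in> {i \<in> ?Z <+> ?Z. q i = quad_form A l}" using l by (auto simp: q_def)
  qed (use no in \<open>auto simp: w_def q_def\<close>)
  ultimately show ?thesis using that by force
qed

text \<open>
  Near a generic form, equality of theta functions forces equality of the values at each test
  vector, and these values determine the form.
\<close>

proposition Theta_locally_injective:
  assumes A: "A \<in> generic_forms"
  shows "locally_injective_at Quad_pos Theta A"
proof -
  obtain d where "0 < d" and d: "\<And>B B' l m. B \<in> ball A d \<Longrightarrow> B' \<in> ball A d \<Longrightarrow> l \<in> test_vectors \<Longrightarrow>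
      m \<in> int_vectors \<Longrightarrow> quad_form B' m = quad_form B l \<Longrightarrow> m = l \<or> m = - l"
    by (rule generic_forms_isolated[OF A]) blast
  have "inj_on Theta (Quad_pos \<inter> ball A d)"
  proof (rule inj_onI)
    fix B C assume B: "B \<in> Quad_pos \<inter> ball A d" and C: "C \<in> Quad_pos \<inter> ball A d"
      and eq: "Theta B = Theta C"
    have "quad_form (B - C) l = 0" if l: "l \<in> test_vectors" for l
    proof -
      obtain m where m: "m \<in> int_vectors" "quad_form C m = quad_form B l"
        using Theta_eq_imp_same_values[OF _ _ eq, of l] B C l test_vectors_int by blast
      then have "m = l \<or> m = - l" using d[of B C l m] B C l by auto
      then show ?thesis using m(2) by (auto simp: quad_form_diff)
    qed
    moreover have "transpose (B - C) = B - C"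
      using B C by (simp add: Quad_pos_def transpose_def vec_eq_iff)
    ultimately have "B - C = 0" by (intro symmetric_zero_if_zero_on_test_vectors)
    then show "B = C" by simp
  qed
  moreover have "A \<in> Quad_pos" using A by (simp add: generic_forms_def)
  ultimately show ?thesis
    unfolding locally_injective_at_def using \<open>0 < d\<close>
    by (intro exI[of _ "Quad_pos \<inter> ball A d"]) (auto intro: openin_open_Int)
qed

section \<open>A Wronskian of exponential sums\<close>

lemma has_sum_finite_sum:
  fixes f :: "'j \<Rightarrow> 'i \<Rightarrow> real"
  assumes "finite J" "\<And>j. j \<in> J \<Longrightarrow> f j summable_on I"
  shows "((\<lambda>i. \<Sum>j\<in>J. f j i) has_sum (\<Sum>j\<in>J. \<Sum>\<^sub>\<infinity>i\<in>I. f j i)) I"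
  using assms
proof (induction J rule: finite_induct)
  case (insert j J)
  then show ?case by (simp add: has_sum_add)
qed simp

lemma det_eq_0_imp_kernel:
  fixes f :: "nat \<Rightarrow> nat \<Rightarrow> 'a::field"
  assumes "Determinant.det (Matrix.mat m m (\<lambda>(i, j). f i j)) = 0"
  obtains t where "\<exists>j<m. t j \<noteq> 0" "\<And>i. i < m \<Longrightarrow> (\<Sum>j<m. f i j * t j) = 0"
proof -
  have M: "Matrix.mat m m (\<lambda>(i, j). f i j) \<in> carrier_mat m m" by simp
  obtain v where v: "v \<in> carrier_vec m" "v \<noteq> 0\<^sub>v m"
      and z: "Matrix.mat m m (\<lambda>(i, j). f i j) *\<^sub>v v = 0\<^sub>v m"
    using assms det_0_iff_vec_prod_zero_field[OF M] by blast
  show ?thesis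
  proof (rule that[of "vec_index v"])
    show "\<exists>j<m. vec_index v j \<noteq> 0"
    proof (rule ccontr)
      assume "\<not> (\<exists>j<m. vec_index v j \<noteq> 0)"
      then have "v = 0\<^sub>v m" using v(1) by (intro eq_vecI) auto
      then show False using v(2) by simp
    qed
    show "(\<Sum>j<m. f i j * vec_index v j) = 0" if i: "i < m" for i
    proof -
      have "vec_index (Matrix.mat m m (\<lambda>(i, j). f i j) *\<^sub>v v) i = 0"
        using z i by simp
      then show ?thesis
        using v(1) i by (simp add: mult_mat_vec_def Matrix.scalar_prod_def atLeast0LessThan)
    qed
  qed
qed

lemma det_zero_row:
  fixes f :: "nat \<Rightarrow> nat \<Rightarrow> 'a::field"
  assumes r: "r < m" and z: "\<And>j. j < m \<Longrightarrow> f r j = 0"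
  shows "Determinant.det (Matrix.mat m m (\<lambda>(i, j). f i j)) = 0"
proof -
  let ?M = "Matrix.mat m m (\<lambda>(i, j). f i j)"
  have prod0: "(\<Prod>i = 0..<m. ?M $$ (i, p i)) = 0" if "p permutes {0..<m}" for p
    using r z permutes_in_image[OF that, of r] by (intro prod_zero bexI[of _ r]) auto
  have "Determinant.det ?M = (\<Sum>p | p permutes {0..<m}. signof p * (\<Prod>i = 0..<m. ?M $$ (i, p i)))"
    by (rule det_def') simp
  also have "\<dots> = 0"
    by (intro sum.neutral ballI) (simp only: mem_Collect_eq prod0 mult_zero_right)
  finally show ?thesis .
qed

text \<open>
  Padding the system with zero rows makes it square and singular.
\<close>

lemma underdetermined_system:
  fixes c :: "'b \<Rightarrow> nat \<Rightarrow> real"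
  assumes E: "finite E" "card E < m"
  obtains t where "\<exists>j<m. t j \<noteq> 0" "\<And>a. a \<in> E \<Longrightarrow> (\<Sum>j<m. c a j * t j) = 0"
proof -
  obtain h where h: "bij_betw h {0..<card E} E"
    using ex_bij_betw_nat_finite[OF E(1)] by blast
  define f where "f = (\<lambda>i j. if i < card E then c (h i) j else 0)"
  have "Determinant.det (Matrix.mat m m (\<lambda>(i, j). f i j)) = 0"
    by (rule det_zero_row[OF E(2)]) (simp add: f_def)
  then obtain t where t: "\<exists>j<m. t j \<noteq> 0" "\<And>i. i < m \<Longrightarrow> (\<Sum>j<m. f i j * t j) = 0"
    by (rule det_eq_0_imp_kernel) blast
  show ?thesis
  proof (rule that[OF t(1)])
    fix a assume "a \<in> E"
    then have "a \<in> h ` {0..<card E}" using h by (simp add: bij_betw_def)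
    then obtain i where "i < card E" "a = h i" by auto
    then show "(\<Sum>j<m. c a j * t j) = 0"
      using t(2)[of i] E(2) by (simp add: f_def)
  qed
qed

lemma tendsto_det:
  fixes f :: "'a \<Rightarrow> nat \<Rightarrow> nat \<Rightarrow> real"
  assumes "\<And>i j. i < m \<Longrightarrow> j < m \<Longrightarrow> ((\<lambda>y. f y i j) \<longlongrightarrow> g i j) F"
  shows "((\<lambda>y. Determinant.det (Matrix.mat m m (\<lambda>(i, j). f y i j))) \<longlongrightarrow>
            Determinant.det (Matrix.mat m m (\<lambda>(i, j). g i j))) F"
proof -
  have det: "Determinant.det (Matrix.mat m m (\<lambda>(i, j). u i j))
      = (\<Sum>p | p permutes {0..<m}. signof p * (\<Prod>i = 0..<m. u i (p i)))" for u :: "nat \<Rightarrow> nat \<Rightarrow> real"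
  proof -
    have "(\<Prod>i = 0..<m. Matrix.mat m m (\<lambda>(i, j). u i j) $$ (i, p i)) = (\<Prod>i = 0..<m. u i (p i))"
      if "p permutes {0..<m}" for p
      using permutes_in_image[OF that] by (intro prod.cong) auto
    then show ?thesis unfolding Determinant.det_def by simp
  qed
  have "((\<lambda>y. f y i (p i)) \<longlongrightarrow> g i (p i)) F" if "p permutes {0..<m}" "i \<in> {0..<m}" for p i
    using assms[of i "p i"] permutes_in_image[OF that(1), of i] that(2) by auto
  then show ?thesis
    unfolding det by (intro tendsto_sum tendsto_mult tendsto_const tendsto_prod) auto
qed

text \<open>
  A linear relation between the rows is a nonzero polynomial of degree less than \<open>m\<close> with the \<open>m\<close>
  roots \<open>a\<^sub>i\<close>.
\<close>

lemma scaled_vandermonde_nonzero: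
  fixes a c :: "nat \<Rightarrow> real"
  assumes inj: "inj_on a {..<m}" and c: "\<And>i. i < m \<Longrightarrow> c i \<noteq> 0"
  shows "Determinant.det (Matrix.mat m m (\<lambda>(k, i). a i ^ k * c i)) \<noteq> 0"
proof
  let ?M = "Matrix.mat m m (\<lambda>(k, i). a i ^ k * c i)"
  assume "Determinant.det ?M = 0"
  moreover have "Matrix.mat m m (\<lambda>(i, k). a i ^ k * c i) = transpose_mat ?M"
    by (rule eq_matI) auto
  moreover have "Determinant.det (transpose_mat ?M) = Determinant.det ?M"
    by (rule Determinant.det_transpose[of _ m]) simp
  ultimately have "Determinant.det (Matrix.mat m m (\<lambda>(i, k). a i ^ k * c i)) = 0" by simp
  then obtain t where t: "\<exists>k<m. t k \<noteq> 0" "\<And>i. i < m \<Longrightarrow> (\<Sum>k<m. a i ^ k * c i * t k) = 0"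
    by (rule det_eq_0_imp_kernel) blast
  define p where "p = (\<Sum>k<m. Polynomial.monom (t k) k)"
  have coeff: "coeff p k = (if k < m then t k else 0)" for k
    by (simp add: p_def coeff_sum)
  have p: "p \<noteq> 0" using t(1) coeff by (metis coeff_0)
  have "poly p (a i) = 0" if "i < m" for i
  proof -
    have "c i * poly p (a i) = (\<Sum>k<m. a i ^ k * c i * t k)"
      by (simp add: p_def poly_sum poly_monom sum_distrib_left mult_ac)
    then show ?thesis using t(2)[OF that] c[OF that] by simp
  qed
  then have "a ` {..<m} \<subseteq> {x. poly p x = 0}" by auto
  then have "card (a ` {..<m}) \<le> card {x. poly p x = 0}"
    using p by (intro card_mono poly_roots_finite)
  then have "m \<le> card {x. poly p x = 0}" using inj by (simp add: card_image)
  also have "\<dots> \<le> degree p" using p by (rule card_poly_roots_bound)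
  finally have "m \<le> degree p" .
  moreover have "0 < m" using t(1) by auto
  ultimately have "lead_coeff p = 0" using coeff[of "degree p"] by simp
  then show False using p by simp
qed

text \<open>
  If the Wronskian is multiplied on the right by a matrix that replaces the \<open>w\<^sub>j\<close> by linear
  combinations with pairwise distinct lowest exponents \<open>a\<^sub>i\<close> and rescales them by \<open>exp (y a\<^sub>i)\<close>, then its
  entries converge for \<open>y \<rightarrow> \<infinity>\<close>, and the limit is a Vandermonde matrix with its columns multiplied by
  nonzero constants.
\<close>

proposition exponential_wronskian_nonzero:
  fixes w :: "nat \<Rightarrow> 'i \<Rightarrow> real"
  assumes w: "\<And>j. j < m \<Longrightarrow> heat_summable I q (w j)"
    and q: "\<And>i. i \<in> I \<Longrightarrow> 0 \<le> q i" and fin: "\<And>C. finite {i \<in> I. q i \<le> C}"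
    and indep: "\<And>t. \<exists>j<m. t j \<noteq> 0 \<Longrightarrow> \<exists>a. (\<Sum>j<m. level_weight I q (w j) a * t j) \<noteq> 0"
  obtains y where "0 < y"
    "Determinant.det (Matrix.mat m m (\<lambda>(k, j). \<Sum>\<^sub>\<infinity>i\<in>I. w j i * q i ^ k * exp (- (y * q i)))) \<noteq> 0"
proof -
  define comb where "comb = (\<lambda>t i. \<Sum>j<m. w j i * t j)"
  have comb_level: "level_weight I q (\<lambda>i. comb t i * q i ^ k) a
      = (\<Sum>j<m. level_weight I q (w j) a * t j) * a ^ k" for t a k
  proof -
    have "level_weight I q (\<lambda>i. comb t i * q i ^ k) a = (\<Sum>i | i \<in> I \<and> q i = a. comb t i * a ^ k)"
      unfolding level_weight_def by (rule sum.cong) auto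
    also have "\<dots> = (\<Sum>j<m. level_weight I q (w j) a * t j) * a ^ k"
      unfolding level_weight_def comb_def sum_distrib_right by (rule sum.swap)
    finally show ?thesis .
  qed
  have comb_level0: "level_weight I q (comb t) a = (\<Sum>j<m. level_weight I q (w j) a * t j)" for t a
    using comb_level[of t 0 a] by simp
  have comb_summable: "heat_summable I q (\<lambda>i. comb t i * q i ^ k)" for t k
  proof (rule heat_summable_times_exponent_power[OF _ q])
    show "heat_summable I q (comb t)"
      unfolding heat_summable_def
    proof (intro allI impI)
      fix y :: real assume y: "0 < y"
      have "(\<lambda>i. \<Sum>j<m. \<bar>w j i\<bar> * exp (- (y * q i)) * \<bar>t j\<bar>) summable_on I"
        using w by (intro has_sum_imp_summable[OF has_sum_finite_sum] summable_on_cmult_left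
            heat_summable_abs y) auto
      then show "(\<lambda>i. \<bar>comb t i\<bar> * exp (- (y * q i))) summable_on I"
      proof (rule summable_on_comparison_test)
        fix i
        have "\<bar>comb t i\<bar> \<le> (\<Sum>j<m. \<bar>w j i * t j\<bar>)" unfolding comb_def by (rule sum_abs)
        then have "\<bar>comb t i\<bar> * exp (- (y * q i)) \<le> (\<Sum>j<m. \<bar>w j i * t j\<bar>) * exp (- (y * q i))"
          by (rule mult_right_mono) simp
        also have "\<dots> = (\<Sum>j<m. \<bar>w j i\<bar> * exp (- (y * q i)) * \<bar>t j\<bar>)"
          unfolding sum_distrib_right by (rule sum.cong) (simp_all add: abs_mult)
        finally show "\<bar>comb t i\<bar> * exp (- (y * q i)) \<le> (\<Sum>j<m. \<bar>w j i\<bar> * exp (- (y * q i)) * \<bar>t j\<bar>)" .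
      qed auto
    qed
  qed
  define lowest_exponent where "lowest_exponent = (\<lambda>t a. level_weight I q (comb t) a \<noteq> 0 \<and>
      (\<forall>a'<a. level_weight I q (comb t) a' = 0))"
  define E where "E = {a. \<exists>t. lowest_exponent t a}"
  \<comment> \<open>If the set of lowest exponents had fewer than \<open>m\<close> elements, a nonzero combination could avoid all
      of them, but it has a lowest exponent itself.\<close>
  have many: "\<not> (finite E \<and> card E < m)"
  proof
    assume "finite E \<and> card E < m"
    then obtain t where t: "\<exists>j<m. t j \<noteq> 0"
        "\<And>a. a \<in> E \<Longrightarrow> (\<Sum>j<m. level_weight I q (w j) a * t j) = 0"
      using underdetermined_system[of E m "\<lambda>a j. level_weight I q (w j) a"] by blast
    obtain a where "level_weight I q (comb t) a \<noteq> 0"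
      using indep[OF t(1)] by (auto simp: comb_level0)
    with fin obtain a0 where "lowest_exponent t a0"
      unfolding lowest_exponent_def by (rule least_nonzero_level) blast
    then have "a0 \<in> E" "level_weight I q (comb t) a0 \<noteq> 0" by (auto simp: E_def lowest_exponent_def)
    then show False using t(2) by (simp add: comb_level0)
  qed
  obtain E' where E': "E' \<subseteq> E" "finite E'" "card E' = m"
  proof (cases "finite E")
    case True
    then show ?thesis using many obtain_subset_with_card_n[of m E] that by (metis not_less finite_subset)
  next
    case False
    then show ?thesis using infinite_arbitrarily_large[of E m] that by blast
  qed
  obtain a where a: "bij_betw a {..<m} E'"
    using ex_bij_betw_nat_finite[OF E'(2)] E'(3) by (auto simp: atLeast0LessThan)
  have "\<exists>t. lowest_exponent t (a i)" if "i < m" for i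
    using that a E'(1) by (auto simp: bij_betw_def E_def)
  then obtain t where t: "\<And>i. i < m \<Longrightarrow> lowest_exponent (t i) (a i)" by metis
  define c where "c = (\<lambda>i. level_weight I q (comb (t i)) (a i))"
  define M where "M = (\<lambda>y. Matrix.mat m m (\<lambda>(k, j). \<Sum>\<^sub>\<infinity>i\<in>I. w j i * q i ^ k * exp (- (y * q i))))"
  \<comment> \<open>The Wronskian matrix after the change of basis and the rescaling of its columns.\<close>
  define N where "N = (\<lambda>y k i. exp (y * a i) * (\<Sum>\<^sub>\<infinity>l\<in>I. comb (t i) l * q l ^ k * exp (- (y * q l))))"
  have "((\<lambda>y. Determinant.det (Matrix.mat m m (\<lambda>(k, i). N y k i))) \<longlongrightarrow>
      Determinant.det (Matrix.mat m m (\<lambda>(k, i). a i ^ k * c i))) at_top"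
  proof (rule tendsto_det)
    fix k i assume "i < m"
    have "((\<lambda>y. N y k i) \<longlongrightarrow> level_weight I q (\<lambda>l. comb (t i) l * q l ^ k) (a i)) at_top"
      unfolding N_def
      by (rule leading_term_tendsto[OF comb_summable fin])
         (use t[OF \<open>i < m\<close>] in \<open>simp add: comb_level lowest_exponent_def comb_level0\<close>)
    then show "((\<lambda>y. N y k i) \<longlongrightarrow> a i ^ k * c i) at_top"
      by (simp only: comb_level c_def comb_level0 mult.commute[of "a i ^ k"])
  qed
  moreover have "Determinant.det (Matrix.mat m m (\<lambda>(k, i). a i ^ k * c i)) \<noteq> 0"
    using a t by (intro scaled_vandermonde_nonzero) (auto simp: bij_betw_def c_def lowest_exponent_def)
  ultimately have "eventually (\<lambda>y. Determinant.det (Matrix.mat m m (\<lambda>(k, i). N y k i)) \<noteq> 0) at_top"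
    by (rule tendsto_imp_eventually_ne)
  then have "eventually (\<lambda>y. 0 < y \<and> Determinant.det (Matrix.mat m m (\<lambda>(k, i). N y k i)) \<noteq> 0) at_top"
    using eventually_gt_at_top[of 0] by eventually_elim auto
  then have "\<exists>y. 0 < y \<and> Determinant.det (Matrix.mat m m (\<lambda>(k, i). N y k i)) \<noteq> 0"
    by (rule eventually_happens'[OF trivial_limit_at_top_linorder])
  then obtain y where y: "0 < y" "Determinant.det (Matrix.mat m m (\<lambda>(k, i). N y k i)) \<noteq> 0"
    by blast
  define T where "T = Matrix.mat m m (\<lambda>(j, i). exp (y * a i) * t i j)"
  have MT: "Matrix.mat m m (\<lambda>(k, i). N y k i) = M y * T"
  proof (rule eq_matI)
    fix k i assume "k < dim_row (M y * T)" "i < dim_col (M y * T)"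
    then have ki: "k < m" "i < m" by (auto simp: M_def T_def)
    have s: "(\<lambda>l. w j l * q l ^ k * exp (- (y * q l))) summable_on I" if "j < m" for j
      by (intro heat_summable_sum[OF heat_summable_times_exponent_power] w q that y(1))
    have "(\<Sum>\<^sub>\<infinity>l\<in>I. comb (t i) l * q l ^ k * exp (- (y * q l)))
        = (\<Sum>\<^sub>\<infinity>l\<in>I. \<Sum>j<m. w j l * q l ^ k * exp (- (y * q l)) * t i j)"
      unfolding comb_def sum_distrib_right by (intro infsum_cong sum.cong) (simp_all add: mult_ac)
    also have "\<dots> = (\<Sum>j<m. \<Sum>\<^sub>\<infinity>l\<in>I. w j l * q l ^ k * exp (- (y * q l)) * t i j)"
      using s by (intro infsumI has_sum_finite_sum summable_on_cmult_left) auto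
    also have "\<dots> = (\<Sum>j<m. (\<Sum>\<^sub>\<infinity>l\<in>I. w j l * q l ^ k * exp (- (y * q l))) * t i j)"
      by (simp add: infsum_cmult_left')
    finally show "Matrix.mat m m (\<lambda>(k, i). N y k i) $$ (k, i) = (M y * T) $$ (k, i)"
      using ki by (simp add: N_def M_def T_def Matrix.scalar_prod_def sum_distrib_left
          atLeast0LessThan mult_ac)
  qed (auto simp: M_def T_def)
  have "Determinant.det (M y * T) = Determinant.det (M y) * Determinant.det T"
    by (rule Determinant.det_mult[of _ m]) (auto simp: M_def T_def)
  then have "Determinant.det (M y) \<noteq> 0" using y(2) MT by auto
  then show ?thesis using y(1) that unfolding M_def by blast
qed

section \<open>Nonvanishing of the determinant\<close>

lemma level_weight_sum_scaled:
  "level_weight I q (\<lambda>i. \<Sum>j\<in>J. w j i * t j) a = (\<Sum>j\<in>J. level_weight I q (w j) a * t j)"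
  unfolding level_weight_def sum_distrib_right by (rule sum.swap)

lemma quad_form_sum: "quad_form (\<Sum>j\<in>J. t j *\<^sub>R h j) x = (\<Sum>j\<in>J. quad_form (h j) x * t j)"
proof (induction J rule: infinite_finite_induct)
  case (insert j J)
  then show ?case by (simp add: quad_form_add quad_form_scaleR mult.commute)
qed (simp_all add: quad_form_def)

lemma linear_form_inner: "linear (\<lambda>H. form_inner H K)"
  by (rule linearI)
     (simp_all add: form_inner_def trace_def matrix_matrix_mult_def sum.distrib sum_distrib_left
        algebra_simps)

text \<open>
  The inner product of the combination with \<open>h\<^sub>j\<close> is the coefficient \<open>t\<^sub>j\<close>.
\<close>

lemma orthonormal_harmonic_basis_independent:
  fixes h :: "nat \<Rightarrow> real^'n^'n"
  assumes h: "orthonormal_harmonic_basis h" and zero: "(\<Sum>j<harmonic_dim TYPE('n). t j *\<^sub>R h j) = 0"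
    and j: "j < harmonic_dim TYPE('n)"
  shows "t j = 0"
proof -
  have "0 = form_inner (\<Sum>i<harmonic_dim TYPE('n). t i *\<^sub>R h i) (h j)"
    unfolding zero by (simp add: form_inner_def trace_def matrix_matrix_mult_def)
  also have "\<dots> = (\<Sum>i<harmonic_dim TYPE('n). t i * form_inner (h i) (h j))"
    by (simp add: linear_sum[OF linear_form_inner] linear_cmul[OF linear_form_inner])
  also have "\<dots> = (\<Sum>i<harmonic_dim TYPE('n). if i = j then t j else 0)"
    using h j by (intro sum.cong) (auto simp: orthonormal_harmonic_basis_def)
  also have "\<dots> = t j" using j by simp
  finally show ?thesis by simp
qed

text \<open>
  On the imaginary axis the determinant is the real Wronskian of the exponential sums with exponents
  \<open>\<parallel>l\<parallel>\<^sup>2\<close> and weights \<open>h\<^sub>j(l)\<close>. Their independence is where genericity enters: on the level of a test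
  vector \<open>l\<close> there are only the lattice vectors \<open>\<plusminus>Q l\<close>, so a combination \<open>H\<close> of the \<open>h\<^sub>j\<close> without
  nonzero level weights satisfies \<open>H(Q l) = 0\<close> for all test vectors \<open>l\<close>. Hence \<open>Q\<^sup>T H Q = 0\<close> and \<open>H = 0\<close>.
\<close>

proposition det_DTheta_nonzero:
  fixes A :: "real^'n^'n"
  assumes A: "A \<in> generic_forms" and L: "is_lattice_of A L" and h: "orthonormal_harmonic_basis h"
  obtains z where "z \<in> upper_half_plane" "det_DTheta h L z \<noteq> 0"
proof -
  let ?m = "harmonic_dim TYPE('n)"
  have pos: "A \<in> Quad_pos" using A by (simp add: generic_forms_def)
  obtain Q where AQ: "A = transpose Q ** Q" and LQ: "L = column_lattice Q"
    using L by (auto simp: is_lattice_of_def)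
  have qQ: "quad_form A x = (norm (Q *v x))\<^sup>2" for x unfolding AQ by (rule quad_form_gram)
  have inj: "inj ((*v) Q)"
  proof (rule injI)
    fix x y assume "Q *v x = Q *v y"
    then have "quad_form A (x - y) = 0" by (simp add: qQ matrix_vector_mult_diff_distrib)
    moreover have "0 < quad_form A (x - y)" if "x \<noteq> y"
      using pos that by (simp add: Quad_pos_def)
    ultimately show "x = y" by force
  qed
  define q :: "real^'n \<Rightarrow> real" where "q = (\<lambda>l. (norm l)\<^sup>2)"
  have q: "0 \<le> q l" for l by (simp add: q_def)
  have I1: "heat_summable L q (\<lambda>_. 1)"
    using heat_summable_quad_form[OF pos] inj_on_subset[OF inj subset_UNIV]
    by (simp add: heat_summable_def LQ column_lattice_def summable_on_reindex o_def q_def qQ)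
  have w: "heat_summable L q (quad_form H)" for H
    by (rule heat_summable_comparison[OF heat_summable_times_exponent[OF I1 q], of _ "norm H"])
       (simp add: q_def abs_quad_form_le)
  have sym: "transpose (h j) = h j" if "j < ?m" for j
  proof -
    have "h j \<in> span (h ` {..<?m})" using that by (intro span_base) simp
    then show ?thesis using h by (simp add: orthonormal_harmonic_basis_def harmonic_forms_def)
  qed
  have indep: "\<exists>a. (\<Sum>j<?m. level_weight L q (quad_form (h j)) a * t j) \<noteq> 0" if t: "\<exists>j<?m. t j \<noteq> 0" for t
  proof (rule ccontr)
    assume "\<nexists>a. (\<Sum>j<?m. level_weight L q (quad_form (h j)) a * t j) \<noteq> 0"
    define H where "H = (\<Sum>j<?m. t j *\<^sub>R h j)"
    have lev: "level_weight L q (quad_form H) a = 0" for a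
      using \<open>\<nexists>a. _\<close> unfolding H_def quad_form_sum level_weight_sum_scaled by simp
    have symH: "transpose H = H"
    proof -
      have "h j $ k $ i = h j $ i $ k" if "j < ?m" for i j k
        using sym[OF that] by (metis transpose_def vec_lambda_beta)
      then show ?thesis
        by (simp add: H_def transpose_def vec_eq_iff sum_component)
    qed
    have "quad_form (transpose Q ** H ** Q) l = 0" if l: "l \<in> test_vectors" for l
    proof -
      \<comment> \<open>Here the genericity of \<open>A\<close> is used.\<close>
      have "{i. i \<in> L \<and> q i = quad_form A l} = {Q *v l, Q *v (- l)}"
      proof (intro equalityI subsetI)
        fix i assume "i \<in> {i. i \<in> L \<and> q i = quad_form A l}"
        then obtain m where m: "m \<in> int_vectors" "i = Q *v m" "quad_form A m = quad_form A l"
          by (auto simp: LQ column_lattice_def q_def qQ)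
        then have "m = l \<or> m = - l" using A l by (auto simp: generic_forms_def)
        then show "i \<in> {Q *v l, Q *v (- l)}" using m(2) by auto
      next
        fix i assume i: "i \<in> {Q *v l, Q *v (- l)}"
        have "l \<in> int_vectors" using l test_vectors_int by auto
        moreover from this have "- l \<in> int_vectors" by (simp add: int_vectors_def)
        ultimately show "i \<in> {i. i \<in> L \<and> q i = quad_form A l}"
          using i quad_form_minus[of A l, unfolded qQ] by (auto simp: LQ column_lattice_def q_def qQ)
      qed
      moreover have "Q *v l \<noteq> Q *v (- l)"
      proof
        assume "Q *v l = Q *v (- l)"
        then have "l = - l" using inj by (simp add: inj_eq)
        then have "l = 0" by (simp add: vec_eq_iff)
        then show False using test_vectors_nonzero[OF l] by simp
      qed
      ultimately have "quad_form H (Q *v l) + quad_form H (Q *v (- l)) = 0"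
        using lev[of "quad_form A l"] by (simp add: level_weight_def)
      then show ?thesis
        using quad_form_minus[of "transpose Q ** H ** Q" l] unfolding quad_form_transpose_mult by linarith
    qed
    moreover have "transpose (transpose Q ** H ** Q) = transpose Q ** H ** Q"
      by (simp add: matrix_transpose_mul symH matrix_mul_assoc)
    ultimately have "transpose Q ** H ** Q = 0"
      by (intro symmetric_zero_if_zero_on_test_vectors)
    then have zQ: "quad_form H (Q *v x) = 0" for x
      unfolding quad_form_transpose_mult[symmetric] by (simp add: quad_form_def)
    have "surj ((*v) Q)"
      using inj by (intro linear_inj_imp_surj matrix_vector_mul_linear)
    then have "quad_form H x = 0" for x by (metis zQ surjD)
    with symH have "H = 0" by (intro symmetric_zero_if_zero_on_test_vectors)
    then show False
      using t orthonormal_harmonic_basis_independent[OF h] unfolding H_def by blast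
  qed
  obtain y where y: "0 < y" "Determinant.det (Matrix.mat ?m ?m
      (\<lambda>(k, j). \<Sum>\<^sub>\<infinity>l\<in>L. quad_form (h j) l * q l ^ k * exp (- (y * q l)))) \<noteq> 0"
    by (rule exponential_wronskian_nonzero[OF w q finite_exponents_below[OF I1] indep]) auto
  define z where "z = \<i> * of_real (y / (2 * pi))"
  have z: "0 < Im z" using y(1) by (simp add: z_def)
  have entry: "(ddz ^^ k) (Theta_harmonic (h j) L) z
      = of_real (\<Sum>\<^sub>\<infinity>l\<in>L. quad_form (h j) l * q l ^ k * exp (- (y * q l)))" for k j
  proof -
    have "Theta_harmonic (h j) L = theta_series L q (quad_form (h j))"
      by (simp add: fun_eq_iff Theta_harmonic_def theta_series_def q_def)
    then have "(ddz ^^ k) (Theta_harmonic (h j) L) z = theta_series L q (\<lambda>l. quad_form (h j) l * q l ^ k) z"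
      using ddz_power_theta_series[OF w q z] by simp
    also have "\<dots> = of_real (\<Sum>\<^sub>\<infinity>l\<in>L. quad_form (h j) l * q l ^ k * exp (- (y * q l)))"
      unfolding z_def
      by (intro theta_series_imaginary_axis heat_summable_times_exponent_power w q y(1))
    finally show ?thesis .
  qed
  let ?R = "Matrix.mat ?m ?m (\<lambda>(k, j). \<Sum>\<^sub>\<infinity>l\<in>L. quad_form (h j) l * q l ^ k * exp (- (y * q l)))"
  have "Matrix.mat ?m ?m (\<lambda>(k, j). (ddz ^^ k) (Theta_harmonic (h j) L) z) = map_mat of_real ?R"
    by (rule eq_matI) (auto simp: entry)
  then have "det_DTheta h L z = of_real (Determinant.det ?R)"
    by (simp only: det_DTheta_def of_real_hom.hom_det)
  then have "det_DTheta h L z \<noteq> 0" using y(2) by simp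
  with z show ?thesis by (intro that[of z]) (auto simp: upper_half_plane_def)
qed

theorem proposition4p2:
  shows "generically (Quad_pos :: (real^'n^'n) set)
    (\<lambda>A. (\<forall>L h. is_lattice_of A L \<longrightarrow> orthonormal_harmonic_basis h \<longrightarrow>
             (\<exists>z\<in>upper_half_plane. det_DTheta h L z \<noteq> 0)) \<and>
         locally_injective_at Quad_pos Theta A)"
  by (rule generically_generic_forms) (blast intro: Theta_locally_injective elim: det_DTheta_nonzero)

end
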